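(* Let $Q$ be a symmetric polynomial in $d$ variables over $\mathbb{C}$ that is multilinear (degree at most $1$ in each variable), with $Q(\mathbf 0)\ne0$, and let $F=1/Q$. Let $\delta^Q(x)=Q(x,\dots,x)$, and let $x\in\mathbb{C}$ be a zero of $\delta^Q$ of minimal modulus. Then $\mathbf x:=(x,\dots,x)$ is a minimal point for $F$ in $\mathrm{crit}(1,\dots,1)$.
   Context: Let $\mathcal V=\{\mathbf z\in\mathbb{C}^d: Q(\mathbf z)=0\}$, equipped with a Whitney stratification into smooth manifolds. For a direction $\hat{\mathbf r}$ in the positive orthant, $\mathrm{crit}(\hat{\mathbf r})$ is the set of $\mathbf z\in\mathcal V$ such that $\hat{\mathbf r}$ is orthogonal, in logarithmic coordinates, to the tangent space of the stratum containing $\mathbf z$ (that is, the differential at $\mathbf z$ of $\sum_j \hat r_j\log z_j$ restricted to the stratum vanishes). If $\mathbf z$ is a smooth point of $\mathcal V$ and $Q$ is square-free, this means that $\hat{\mathbf r}$ is parallel to the logarithmic gradient $(z_1\partial Q/\partial z_1,\dots,z_d\partial Q/\partial z_d)$ at $\mathbf z$. A point $\mathbf z\in\mathrm{crit}(\hat{\mathbf r})$ is called minimal if the open polydisk $\{\mathbf w\in\mathbb{C}^d: |w_j|<|z_j|\ \text{for all } 1\le j\le d\}$ does not intersect $\mathcal V$. *)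

theory Defs
  imports "HOL-Analysis.Analysis" "HOL-Library.Poly_Mapping" "HOL-Library.Disjoint_Sets"
begin

section \<open>Polynomials in the variables indexed by a finite type\<close>

text \<open>A monomial is its vector of exponents; a polynomial maps monomials to coefficients.\<close>

type_synonym ('n, 'a) mpolynomial = "('n \<Rightarrow>\<^sub>0 nat) \<Rightarrow>\<^sub>0 'a"

definition mpoly_eval :: "('n::finite, 'a::comm_semiring_1) mpolynomial \<Rightarrow> 'a ^ 'n \<Rightarrow> 'a" where
  "mpoly_eval Q z =
     (\<Sum>m\<in>Poly_Mapping.keys Q. Poly_Mapping.lookup Q m * (\<Prod>j\<in>UNIV. (z $ j) ^ Poly_Mapping.lookup m j))"

definition symmetric_mpoly :: "('n, 'a::zero) mpolynomial \<Rightarrow> bool" where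
  "symmetric_mpoly Q \<longleftrightarrow>
     (\<forall>\<pi>. bij \<pi> \<longrightarrow>
        (\<forall>m. Poly_Mapping.lookup Q (Poly_Mapping.map_key \<pi> m) = Poly_Mapping.lookup Q m))"

definition multilinear_mpoly :: "('n, 'a::zero) mpolynomial \<Rightarrow> bool" where
  "multilinear_mpoly Q \<longleftrightarrow> (\<forall>m\<in>Poly_Mapping.keys Q. \<forall>j. Poly_Mapping.lookup m j \<le> 1)"

definition diagonal :: "('n::finite, 'a::comm_semiring_1) mpolynomial \<Rightarrow> 'a \<Rightarrow> 'a" where
  "diagonal Q x = mpoly_eval Q (\<chi> j. x)"

definition zero_locus :: "('n::finite, 'a::comm_semiring_1) mpolynomial \<Rightarrow> ('a ^ 'n) set" where
  "zero_locus Q = {z. mpoly_eval Q z = 0}"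


section \<open>Smooth submanifolds of a Euclidean space\<close>

text \<open>Functions of class \<open>C\<^sup>k\<close> and of class \<open>C\<^sup>\<infinity>\<close>; only meaningful for open \<open>U\<close>.\<close>

primrec Ck_on ::
    "nat \<Rightarrow> 'a set \<Rightarrow> ('a::real_normed_vector \<Rightarrow> 'b::real_normed_vector) \<Rightarrow> bool" where
  "Ck_on 0 U f \<longleftrightarrow> continuous_on U f"
| "Ck_on (Suc k) U f \<longleftrightarrow>
     f differentiable_on U \<and> (\<forall>v. Ck_on k U (\<lambda>x. frechet_derivative f (at x) v))"

definition smooth_map_on ::
    "'a set \<Rightarrow> ('a::real_normed_vector \<Rightarrow> 'b::real_normed_vector) \<Rightarrow> bool" where
  "smooth_map_on U f \<longleftrightarrow> (\<forall>k. Ck_on k U f)"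

text \<open>Dimensions are over the reals, so strata may be real submanifolds of \<open>\<complex>\<^sup>d\<close>; complex
  submanifolds are a special case.\<close>

definition smooth_submanifold :: "nat \<Rightarrow> 'a::euclidean_space set \<Rightarrow> bool" where
  "smooth_submanifold k S \<longleftrightarrow>
     (\<forall>p\<in>S. \<exists>U W \<phi> \<psi> (L :: 'a set).
        open U \<and> p \<in> U \<and> open W \<and> homeomorphism U W \<phi> \<psi> \<and>
        smooth_map_on U \<phi> \<and> smooth_map_on W \<psi> \<and>
        subspace L \<and> dim L = k \<and> \<phi> ` (S \<inter> U) = L \<inter> W)"

definition tangent_space :: "'a::euclidean_space set \<Rightarrow> 'a \<Rightarrow> 'a set" where
  "tangent_space S p =
     {v. \<exists>(\<gamma> :: real \<Rightarrow> 'a) \<epsilon>. \<epsilon> > 0 \<and> smooth_map_on {-\<epsilon><..<\<epsilon>} \<gamma> \<and>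
           \<gamma> ` {-\<epsilon><..<\<epsilon>} \<subseteq> S \<and> \<gamma> 0 = p \<and> (\<gamma> has_vector_derivative v) (at 0)}"


section \<open>Whitney stratifications\<close>

text \<open>Convergence in the Grassmannian, expressed by convergence of the orthogonal projections:
  for a linear subspace \<open>L\<close>, the map \<open>closest_point L\<close> is the orthogonal projection onto \<open>L\<close>.
  Taking traces, the dimensions of the \<open>T i\<close> are eventually equal to that of \<open>L\<close>.\<close>

definition subspaces_tendsto :: "(nat \<Rightarrow> 'a::euclidean_space set) \<Rightarrow> 'a set \<Rightarrow> bool" where
  "subspaces_tendsto T L \<longleftrightarrow> (\<forall>i. subspace (T i)) \<and> subspace L \<and>
     (\<forall>v. (\<lambda>i. closest_point (T i) v) \<longlonglongrightarrow> closest_point L v)"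

definition whitney_condition_a :: "'a::euclidean_space set \<Rightarrow> 'a set \<Rightarrow> bool" where
  "whitney_condition_a R S \<longleftrightarrow>
     (\<forall>x y T. (\<forall>i. x i \<in> R) \<and> y \<in> S \<and> x \<longlonglongrightarrow> y \<and>
        subspaces_tendsto (\<lambda>i. tangent_space R (x i)) T \<longrightarrow> tangent_space S y \<subseteq> T)"

definition whitney_condition_b :: "'a::euclidean_space set \<Rightarrow> 'a set \<Rightarrow> bool" where
  "whitney_condition_b R S \<longleftrightarrow>
     (\<forall>x s y T l. (\<forall>i. x i \<in> R) \<and> (\<forall>i. s i \<in> S) \<and> y \<in> S \<and> x \<longlonglongrightarrow> y \<and> s \<longlonglongrightarrow> y \<and>
        (\<forall>i. x i \<noteq> s i) \<and> subspaces_tendsto (\<lambda>i. span {x i - s i}) l \<and>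
        subspaces_tendsto (\<lambda>i. tangent_space R (x i)) T \<longrightarrow> l \<subseteq> T)"

definition whitney_stratification :: "'a::euclidean_space set \<Rightarrow> 'a set set \<Rightarrow> bool" where
  "whitney_stratification V \<S> \<longleftrightarrow>
     partition_on V \<S> \<and>
     locally_finite_in (top_of_set V) \<S> \<and>
     (\<forall>S\<in>\<S>. \<exists>k. smooth_submanifold k S) \<and>
     (\<forall>R\<in>\<S>. \<forall>S\<in>\<S>. S \<inter> closure R \<noteq> {} \<longrightarrow> S \<subseteq> closure R) \<and>
     (\<forall>R\<in>\<S>. \<forall>S\<in>\<S>. R \<noteq> S \<and> S \<subseteq> closure R \<longrightarrow>
        whitney_condition_a R S \<and> whitney_condition_b R S)"


section \<open>Critical points and minimal points\<close>

text \<open>In the coordinates \<open>log z\<^sub>j\<close> a tangent vector \<open>v\<close> at \<open>z\<close> becomes \<open>(v\<^sub>j / z\<^sub>j)\<^sub>j\<close>, so the sum below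
  is the differential at \<open>z\<close> of any local branch of \<open>\<Sum>\<^sub>j r\<^sub>j log z\<^sub>j\<close>, applied to \<open>v\<close>. It is
  bilinear, not Hermitian. Logarithmic coordinates exist only where no coordinate vanishes.\<close>

definition log_differential :: "real ^ 'n::finite \<Rightarrow> complex ^ 'n \<Rightarrow> complex ^ 'n \<Rightarrow> complex" where
  "log_differential r z v = (\<Sum>j\<in>UNIV. of_real (r $ j) * (v $ j / z $ j))"

definition crit ::
    "('n::finite, complex) mpolynomial \<Rightarrow> (complex ^ 'n) set set \<Rightarrow> real ^ 'n \<Rightarrow> (complex ^ 'n) set" where
  "crit Q \<S> r =
     {z \<in> zero_locus Q. (\<forall>j. z $ j \<noteq> 0) \<and>
        (\<forall>S\<in>\<S>. z \<in> S \<longrightarrow> (\<forall>v\<in>tangent_space S z. log_differential r z v = 0))}"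

definition open_polydisk :: "complex ^ 'n::finite \<Rightarrow> (complex ^ 'n) set" where
  "open_polydisk z = {w. \<forall>j. cmod (w $ j) < cmod (z $ j)}"

definition minimal_point_in_crit ::
    "('n::finite, complex) mpolynomial \<Rightarrow> (complex ^ 'n) set set \<Rightarrow> real ^ 'n \<Rightarrow> complex ^ 'n \<Rightarrow> bool" where
  "minimal_point_in_crit Q \<S> r z \<longleftrightarrow> z \<in> crit Q \<S> r \<and> open_polydisk z \<inter> zero_locus Q = {}"

end

(* The polydisk: restricting a symmetric multiaffine form in one variable is a polar derivative
   on the diagonal, so Laguerre's theorem, iterated over the variables, shows that the form has no zero
   in a polydisk around 0 if its diagonal has none in the corresponding disk (Grace, Walsh, Szego).

   Criticality: x may be a multiple zero of the diagonal, so that (x,...,x) is a singular point.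
   Write Q(p + w) = sum_A c(|A|) prod_(j in A) w_j with p = (x,...,x), and let m be minimal with
   c(m) nonzero. If |Y| = m - 1, then p + t 1_Y lies on the variety and the gradient there is a
   nonzero multiple of the indicator of the complement of Y. The hyperplane of all v whose sum over
   the complement of Y vanishes is thus a limit of tangent hyperplanes at regular points, so by
   Whitney's condition (a) it contains the tangent space of the stratum of p. Summing over all Y
   gives sum_j v_j = 0. *)

theory Submission
  imports Defs "HOL-Complex_Analysis.Complex_Analysis"
    "HOL-Computational_Algebra.Fundamental_Theorem_Algebra"
begin

section \<open>The Grace-Walsh-Szego theorem for disks\<close>

text \<open>This is the sum of \<open>c k\<close> times the k-th elementary symmetric polynomial in
  \<open>w\<close>. Indexing the variables by a finite set lets them be frozen one at a
  time.\<close>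

definition symform :: "(nat \<Rightarrow> complex) \<Rightarrow> 'i set \<Rightarrow> ('i \<Rightarrow> complex) \<Rightarrow> complex" where
  "symform c I w = (\<Sum>A\<in>Pow I. c (card A) * (\<Prod>j\<in>A. w j))"

text \<open>The diagonal of \<open>symform\<close> in \<open>n\<close> variables: the binomial
  coefficient counts the subsets of size \<open>k\<close>.\<close>

definition binomial_poly :: "nat \<Rightarrow> (nat \<Rightarrow> complex) \<Rightarrow> complex poly" where
  "binomial_poly n c = (\<Sum>k\<le>n. monom (of_nat (n choose k) * c k) k)"

lemma coeff_binomial_poly: "coeff (binomial_poly n c) k = of_nat (n choose k) * c k"
  by (auto simp: binomial_poly_def coeff_sum)

lemma degree_binomial_poly_le: "degree (binomial_poly n c) \<le> n"
  by (rule degree_le) (simp add: coeff_binomial_poly)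

lemma binomial_poly_0 [simp]: "binomial_poly 0 c = [:c 0:]"
  by (simp add: binomial_poly_def monom_0)

lemma binomial_poly_Suc:
  "binomial_poly (Suc n) c = binomial_poly n c + pCons 0 (binomial_poly n (\<lambda>k. c (Suc k)))"
  by (rule poly_eqI) (simp add: coeff_binomial_poly coeff_pCons algebra_simps split: nat.splits)

lemma symform_empty [simp]: "symform c {} w = c 0"
  by (simp add: symform_def)

text \<open>Split the subsets by whether they contain \<open>j\<close>: freezing one variable leaves
  a form of the same kind, with new coefficients.\<close>

lemma symform_insert:
  assumes "finite I" "j \<notin> I"
  shows "symform c (insert j I) w = symform (\<lambda>k. c k + w j * c (Suc k)) I w"
proof -
  have inj: "inj_on (insert j) (Pow I)"
    using assms by (auto simp: inj_on_def)
  have "symform c (insert j I) w = symform c I w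
      + (\<Sum>A\<in>insert j ` Pow I. c (card A) * (\<Prod>j\<in>A. w j))"
    unfolding symform_def Pow_insert using assms by (subst sum.union_disjoint) auto
  also have "(\<Sum>A\<in>insert j ` Pow I. c (card A) * (\<Prod>j\<in>A. w j))
      = (\<Sum>A\<in>Pow I. w j * c (Suc (card A)) * (\<Prod>j\<in>A. w j))"
    unfolding sum.reindex[OF inj]
  proof (rule sum.cong)
    fix A assume "A \<in> Pow I"
    then have "finite A" "j \<notin> A"
      using assms by (auto intro: finite_subset)
    then show "((\<lambda>A. c (card A) * (\<Prod>j\<in>A. w j)) \<circ> insert j) A
        = w j * c (Suc (card A)) * (\<Prod>j\<in>A. w j)"
      by simp
  qed simp
  finally show ?thesis
    by (simp add: symform_def sum.distrib[symmetric] algebra_simps)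
qed

lemma symform_diagonal:
  assumes "finite I"
  shows "symform c I (\<lambda>_. y) = poly (binomial_poly (card I) c) y"
  using assms
proof (induction I arbitrary: c)
  case (insert j I)
  have "symform c (insert j I) (\<lambda>_. y)
      = symform c I (\<lambda>_. y) + y * symform (\<lambda>k. c (Suc k)) I (\<lambda>_. y)"
    using insert.hyps
    by (simp add: symform_insert) (simp add: symform_def sum_distrib_left sum.distrib algebra_simps)
  then show ?case
    using insert by (simp add: binomial_poly_Suc)
qed simp

text \<open>Moving the origin to a diagonal point keeps the symmetry: the new coefficient of the
  product over \<open>B\<close> is a sum over sets \<open>C\<close> disjoint from \<open>B\<close>,
  and it depends on \<open>card B\<close> only.\<close>

lemma symform_shift:
  assumes "finite I"
  obtains b where "\<And>w. symform c I (\<lambda>j. x + w j) = symform b I w"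
proof
  \<comment> \<open>The sum of \<open>c (card B + card C) * x ^ card C\<close> over all
    \<open>C\<close> inside \<open>I - B\<close> is itself a diagonal value, in
    \<open>card I - card B\<close> variables.\<close>
  define b where "b = (\<lambda>k. poly (binomial_poly (card I - k) (\<lambda>l. c (k + l))) x)"
  fix w
  have fin: "finite A" if "A \<subseteq> I" for A
    using that assms by (rule finite_subset)
  have "symform c I (\<lambda>j. x + w j)
      = (\<Sum>A\<in>Pow I. \<Sum>B\<in>Pow A. c (card A) * ((\<Prod>j\<in>B. w j) * x ^ card (A - B)))"
    unfolding symform_def
    by (intro sum.cong refl) (simp add: fin prod_add add.commute[of x] sum_distrib_left)
  also have "\<dots> = (\<Sum>(A,B)\<in>(SIGMA A:Pow I. Pow A). c (card A) * ((\<Prod>j\<in>B. w j) * x ^ card (A - B)))"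
    using fin assms by (subst sum.Sigma) auto
  also have "\<dots> = (\<Sum>(B,C)\<in>(SIGMA B:Pow I. Pow (I - B)).
      c (card B + card C) * ((\<Prod>j\<in>B. w j) * x ^ card C))"
  \<comment> \<open>A set \<open>A\<close> with a subset \<open>B\<close> is recorded as
    \<open>B\<close> together with \<open>C = A - B\<close>.\<close>
  proof (rule sum.reindex_bij_witness[where i = "\<lambda>(B,C). (B \<union> C, B)" and j = "\<lambda>(A,B). (B, A - B)"])
    fix a assume "a \<in> (SIGMA A:Pow I. Pow A)"
    then obtain A B where a: "a = (A,B)" "A \<subseteq> I" "B \<subseteq> A" by auto
    then have "card A = card B + card (A - B)"
      using fin card_mono[of A B] by (simp add: card_Diff_subset finite_subset)
    then show "(case (case a of (A, B) \<Rightarrow> (B, A - B)) of (B, C) \<Rightarrow>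
          c (card B + card C) * ((\<Prod>j\<in>B. w j) * x ^ card C))
        = (case a of (A, B) \<Rightarrow> c (card A) * ((\<Prod>j\<in>B. w j) * x ^ card (A - B)))"
      by (simp add: a)
  qed auto
  also have "\<dots> = (\<Sum>B\<in>Pow I. \<Sum>C\<in>Pow (I - B). c (card B + card C) * ((\<Prod>j\<in>B. w j) * x ^ card C))"
    using fin assms by (subst sum.Sigma) auto
  also have "\<dots> = (\<Sum>B\<in>Pow I. symform (\<lambda>k. c (card B + k)) (I - B) (\<lambda>_. x) * (\<Prod>j\<in>B. w j))"
    by (simp add: symform_def sum_distrib_right sum_distrib_left mult_ac)
  also have "\<dots> = symform b I w"
    unfolding symform_def[of b] unfolding b_def
    using assms fin by (intro sum.cong refl) (simp add: symform_diagonal card_Diff_subset)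
  finally show "symform c I (\<lambda>j. x + w j) = symform b I w" .
qed

section \<open>Laguerre's theorem and its iteration over the variables\<close>

text \<open>Substituting \<open>s = 1 / (r - y)\<close> turns the condition into \<rho> \<le> |r|,
  with \<open>s = 0\<close> for r at infinity. The set is thus the image of the outside of a disk
  under an inversion centred inside that disk, which is a closed disk.\<close>

lemma convex_inverse_disk_complement:
  fixes y :: complex
  assumes "cmod y < \<rho>"
  shows "convex {s. \<rho> * cmod s \<le> cmod (1 + y * s)}"
proof -
  define e where "e = \<rho>\<^sup>2 - (cmod y)\<^sup>2"
  have "\<rho> > 0" using assms norm_ge_zero[of y] by linarith
  then have "e > 0"
    using assms unfolding e_def by (simp add: power_strict_mono)
  \<comment> \<open>Centre and radius come from completing the square in the squared inequality; a
    common factor \<open>e > 0\<close> then cancels.\<close>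
  have "\<rho> * cmod s \<le> cmod (1 + y * s) \<longleftrightarrow> s \<in> cball (cnj y / e) (\<rho> / e)" for s
  proof -
    have "s \<in> cball (cnj y / e) (\<rho> / e) \<longleftrightarrow> e * cmod (cnj y / e - s) \<le> \<rho>"
      using \<open>e > 0\<close> by (simp add: dist_norm field_simps)
    also have "e * cmod (cnj y / e - s) = cmod (of_real e * (cnj y / e - s))"
      using \<open>e > 0\<close> by (simp add: norm_mult)
    also have "\<dots> = cmod (cnj y - e * s)"
      using \<open>e > 0\<close> by (simp add: algebra_simps)
    also have "\<dots> \<le> \<rho> \<longleftrightarrow> (cmod (cnj y - e * s))\<^sup>2 \<le> \<rho>\<^sup>2"
      using \<open>\<rho> > 0\<close> by (simp add: abs_le_square_iff[symmetric])
    also have "(cmod (cnj y - e * s))\<^sup>2 = (cmod y)\<^sup>2 - 2 * e * Re (y * s) + e\<^sup>2 * (cmod s)\<^sup>2"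
      by (simp add: cmod_power2) (simp add: power2_eq_square algebra_simps)
    also have "\<dots> \<le> \<rho>\<^sup>2 \<longleftrightarrow> e * (e * (cmod s)\<^sup>2 - 2 * Re (y * s)) \<le> e * 1"
      by (simp add: e_def power2_eq_square algebra_simps)
    also have "\<dots> \<longleftrightarrow> e * (cmod s)\<^sup>2 - 2 * Re (y * s) \<le> 1"
      using \<open>e > 0\<close> by (subst mult_le_cancel_left_pos) auto
    also have "\<dots> \<longleftrightarrow> \<rho>\<^sup>2 * (cmod s)\<^sup>2 \<le> 1 + 2 * Re (y * s) + (cmod y)\<^sup>2 * (cmod s)\<^sup>2"
      by (simp add: e_def algebra_simps)
    also have "1 + 2 * Re (y * s) + (cmod y)\<^sup>2 * (cmod s)\<^sup>2 = (cmod (1 + y * s))\<^sup>2"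
      by (simp add: cmod_power2) (simp add: power2_eq_square algebra_simps)
    also have "\<rho>\<^sup>2 * (cmod s)\<^sup>2 \<le> (cmod (1 + y * s))\<^sup>2 \<longleftrightarrow> \<rho> * cmod s \<le> cmod (1 + y * s)"
      using \<open>\<rho> > 0\<close> by (simp add: power_mult_distrib[symmetric] abs_le_square_iff[symmetric])
    finally show ?thesis by simp
  qed
  then have "{s. \<rho> * cmod s \<le> cmod (1 + y * s)} = cball (cnj y / e) (\<rho> / e)"
    by blast
  then show ?thesis by simp
qed

text \<open>Minus the logarithmic derivative at \<open>y\<close> is the sum of 1/(r - y) over the
  roots r. Each term lies in the convex set above, hence so does their mean \<open>s\<close>. If the
  degree is below \<open>n\<close>, the missing roots sit at infinity and contribute 0.\<close>

lemma logarithmic_derivative_mean: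
  fixes p :: "complex poly"
  assumes "degree p \<le> n" "\<And>r. poly p r = 0 \<Longrightarrow> \<rho> \<le> cmod r" "cmod y < \<rho>"
  shows "\<exists>s. \<rho> * cmod s \<le> cmod (1 + y * s) \<and> poly (pderiv p) y = - of_nat n * s * poly p y"
  using assms(1,2)
proof (induction n arbitrary: p)
  case 0
  then show ?case
    by (intro exI[of _ 0]) (auto elim!: degree_eq_zeroE simp: pderiv_pCons)
next
  case (Suc n)
  let ?K = "{s. \<rho> * cmod s \<le> cmod (1 + y * s)}"
  show ?case
  proof (cases "degree p = 0")
    case True
    then show ?thesis
      by (intro exI[of _ 0]) (auto elim!: degree_eq_zeroE simp: pderiv_pCons)
  next
    case False
    then obtain r where r: "poly p r = 0"
      using fundamental_theorem_of_algebra_alt[of p] by (metis degree_pCons_0)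
    then obtain q where q: "p = [:- r, 1:] * q"
      by (auto simp: poly_eq_0_iff_dvd dvd_def)
    with False have "q \<noteq> 0" by auto
    then have "degree p = Suc (degree q)"
      unfolding q by (subst degree_mult_eq) auto
    then have "degree q \<le> n" using Suc.prems by simp
    moreover have "\<rho> \<le> cmod z" if "poly q z = 0" for z
      using that Suc.prems(2)[of z] by (simp add: q)
    ultimately obtain s where s: "s \<in> ?K" "poly (pderiv q) y = - of_nat n * s * poly q y"
      using Suc.IH by auto
    have "\<rho> \<le> cmod r" using Suc.prems(2) r by blast
    then have "r \<noteq> y" using assms(3) by auto
    define u where "u = 1 / (r - y)"
    have "1 + y * u = r * u" using \<open>r \<noteq> y\<close> by (simp add: u_def field_simps)
    then have "u \<in> ?K" using \<open>\<rho> \<le> cmod r\<close> by (simp add: norm_mult mult_right_mono)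
    \<comment> \<open>The old mean has weight n/(n+1) and the term \<open>u\<close> of the split-off
      root has weight 1/(n+1).\<close>
    define s' where "s' = (real n / Suc n) *\<^sub>R s + (1 / Suc n) *\<^sub>R u"
    have "s' \<in> ?K"
      unfolding s'_def using convex_inverse_disk_complement[OF assms(3)] s(1) \<open>u \<in> ?K\<close>
      by (rule convexD) (auto simp: field_simps)
    moreover have "of_nat (Suc n) * s' = of_nat n * s + u"
      unfolding s'_def scaleR_conv_of_real by (simp add: field_simps del: of_nat_Suc)
    then have "- of_nat (Suc n) * s' * poly p y = - (of_nat n * s + u) * ((y - r) * poly q y)"
      by (simp add: q left_diff_distrib del: of_nat_Suc)
    moreover have "u * (y - r) = -1" using \<open>r \<noteq> y\<close> by (simp add: u_def field_simps)
    then have "u * ((y - r) * poly q y) = - poly q y"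
      by (simp only: mult.assoc[symmetric]) simp
    then have "- (of_nat n * s + u) * ((y - r) * poly q y) = poly (pderiv p) y"
      unfolding q pderiv_mult by (simp add: s(2) pderiv_pCons distrib_right) (simp add: algebra_simps)
    ultimately show ?thesis by auto
  qed
qed

text \<open>The expression can vanish only if \<open>1 + y * s = \<zeta> * s\<close> for the mean
  \<open>s\<close>. Then \<open>s\<close> is nonzero and \<rho>|s| \<le> |\<zeta>||s|, which is
  impossible for \<zeta> inside the disk.\<close>

lemma laguerre_polar_derivative:
  fixes p :: "complex poly"
  assumes "degree p \<le> n" "n > 0" "\<And>r. poly p r = 0 \<Longrightarrow> \<rho> \<le> cmod r"
    and "cmod y < \<rho>" "cmod \<zeta> < \<rho>"
  shows "of_nat n * poly p y + (\<zeta> - y) * poly (pderiv p) y \<noteq> 0"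
proof
  assume *: "of_nat n * poly p y + (\<zeta> - y) * poly (pderiv p) y = 0"
  obtain s where s: "\<rho> * cmod s \<le> cmod (1 + y * s)"
      "poly (pderiv p) y = - of_nat n * s * poly p y"
    using logarithmic_derivative_mean[OF assms(1,3,4)] by blast
  have "poly p y \<noteq> 0" using assms(3)[of y] assms(4) by auto
  have "of_nat n * poly p y * (1 - (\<zeta> - y) * s) = 0"
    using * by (simp add: s(2) algebra_simps)
  then have eq: "1 + y * s = \<zeta> * s"
    using \<open>poly p y \<noteq> 0\<close> assms(2) by (simp add: left_diff_distrib diff_eq_eq)
  then have "s \<noteq> 0" by auto
  then show False
    using s(1) assms(5) by (simp add: eq norm_mult)
qed

text \<open>Freezing \<open>w j\<close> turns the diagonal, up to the factor \<open>?n\<close>, into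
  its polar derivative with pole \<open>w j\<close>. By Laguerre's theorem this is again zero-free
  in the disk, so the induction hypothesis handles the remaining variables.\<close>

theorem grace_walsh_szego_disk:
  assumes "finite I" "\<rho> > 0" "\<And>i. i \<in> I \<Longrightarrow> cmod (w i) < \<rho>"
    and "\<And>y. cmod y < \<rho> \<Longrightarrow> symform c I (\<lambda>_. y) \<noteq> 0"
  shows "symform c I w \<noteq> 0"
  using assms(1,3,4)
proof (induction I arbitrary: c)
  case empty
  then show ?case using assms(2) by (metis norm_zero symform_empty)
next
  case (insert j I)
  let ?n = "Suc (card I)" and ?c = "\<lambda>k. c k + w j * c (Suc k)"
  let ?p = "binomial_poly ?n c"
  have "symform ?c I (\<lambda>_. y) \<noteq> 0" if y: "cmod y < \<rho>" for y
  proof -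
    \<comment> \<open>\<open>[:w j, -1:]\<close> is w_j - X, so the right side is the polar
      derivative. Coefficients are compared through the absorption identity \<open>1\<close> and its
      combination \<open>2\<close> with Pascal's rule.\<close>
    have "smult (of_nat ?n) (binomial_poly (card I) ?c) = smult (of_nat ?n) ?p + [:w j, -1:] * pderiv ?p"
    proof (rule poly_eqI)
      fix k
      have 1: "of_nat ?n * of_nat (card I choose k) = (of_nat (Suc k * (?n choose Suc k)) :: complex)"
        unfolding Suc_times_binomial of_nat_mult ..
      have 2: "of_nat k * of_nat (?n choose k) + of_nat ?n * of_nat (card I choose k)
          = (of_nat ?n * of_nat (?n choose k) :: complex)"
      proof (cases k)
        case (Suc i)
        have "k * (?n choose k) + ?n * (card I choose k) = ?n * (?n choose k)"
          unfolding Suc Suc_times_binomial by (simp add: algebra_simps)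
        then show ?thesis
          by (metis of_nat_add of_nat_mult)
      qed simp
      show "coeff (smult (of_nat ?n) (binomial_poly (card I) ?c)) k
          = coeff (smult (of_nat ?n) ?p + [:w j, -1:] * pderiv ?p) k"
      proof -
        have "coeff ([:w j, -1:] * pderiv ?p) k
            = w j * (of_nat (Suc k * (?n choose Suc k)) * c (Suc k)) - of_nat k * of_nat (?n choose k) * c k"
          by (cases k) (simp_all add: coeff_binomial_poly coeff_pderiv coeff_pCons algebra_simps
              del: binomial_Suc_Suc)
        moreover have "of_nat k * of_nat (?n choose k)
            = (of_nat ?n * of_nat (?n choose k) - of_nat ?n * of_nat (card I choose k) :: complex)"
          using 2 by (simp add: eq_diff_eq)
        ultimately show ?thesis
          unfolding 1[symmetric]
          by (simp add: coeff_binomial_poly algebra_simps del: binomial_Suc_Suc of_nat_Suc)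
      qed
    qed
    then have "poly (smult (of_nat ?n) (binomial_poly (card I) ?c)) y
        = poly (smult (of_nat ?n) ?p + [:w j, -1:] * pderiv ?p) y"
      by (rule arg_cong)
    then have "of_nat ?n * symform ?c I (\<lambda>_. y) = of_nat ?n * poly ?p y + (w j - y) * poly (pderiv ?p) y"
      by (simp only: symform_diagonal[OF insert.hyps(1)] poly_smult poly_add poly_mult poly_pCons poly_0
          mult_zero_right add_0_right mult_minus1_right diff_conv_add_uminus)
    moreover have "\<rho> \<le> cmod r" if "poly ?p r = 0" for r
      using that insert.prems(2)[of r] insert.hyps by (force simp: symform_diagonal)
    ultimately show ?thesis
      using laguerre_polar_derivative[OF degree_binomial_poly_le, of ?n c \<rho> y "w j"] y insert.prems(1)
      by auto
  qed
  then show ?case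
    using insert by (simp add: symform_insert)
qed

section \<open>Symmetric multilinear polynomials\<close>

text \<open>Multilinearity leaves only squarefree monomials, one for each set \<open>A\<close>.
  Symmetry makes their coefficients depend on \<open>card A\<close> alone, since some permutation
  carries any set to any other of the same size.\<close>

lemma mpoly_eval_eq_symform:
  fixes Q :: "('n::finite, complex) mpolynomial"
  assumes "symmetric_mpoly Q" "multilinear_mpoly Q"
  obtains a where "\<And>z. mpoly_eval Q z = symform a UNIV (\<lambda>j. z $ j)"
proof
  define mono where "mono = (\<lambda>A::'n set. Abs_poly_mapping (\<lambda>j. if j \<in> A then 1 else 0 :: nat))"
  have lookup_mono: "Poly_Mapping.lookup (mono A) = (\<lambda>j. if j \<in> A then 1 else 0)" for A
    unfolding mono_def by (rule lookup_Abs_poly_mapping) simp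
  then have inj: "inj mono"
    by (intro injI) (metis (mono_tags, lifting) set_eqI zero_neq_one)
  \<comment> \<open>The coefficient is read off at one chosen set of each size.\<close>
  define a where "a = (\<lambda>k. Poly_Mapping.lookup Q (mono (SOME A. card A = k)))"
  have lookup_Q: "Poly_Mapping.lookup Q (mono A) = a (card A)" for A
  proof -
    define B where "B = (SOME B::'n set. card B = card A)"
    have "card B = card A"
      unfolding B_def by (rule someI) (rule refl)
    then obtain f where f: "bij_betw f B A"
      using finite_same_card_bij[of B A] by auto
    have "card (- B) = card (- A)"
      using \<open>card B = card A\<close> by (simp add: Compl_eq_Diff_UNIV card_Diff_subset)
    then obtain g where g: "bij_betw g (- B) (- A)"
      using finite_same_card_bij[of "- B" "- A"] by auto
    \<comment> \<open>Bijections between the sets and between their complements are glued to a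
      permutation.\<close>
    define h where "h = (\<lambda>j. if j \<in> B then f j else g j)"
    have hB: "bij_betw h B A"
      using f by (subst bij_betw_cong[where g = f]) (auto simp: h_def)
    have hB': "bij_betw h (- B) (- A)"
      using g by (subst bij_betw_cong[where g = g]) (auto simp: h_def)
    have "bij h"
      using bij_betw_combine[OF hB hB'] by simp
    have "h j \<in> A \<longleftrightarrow> j \<in> B" for j
      using hB hB' by (cases "j \<in> B") (auto dest: bij_betwE)
    then have "Poly_Mapping.map_key h (mono A) = mono B"
      using \<open>bij h\<close> by (intro poly_mapping_eqI) (simp add: map_key.rep_eq bij_is_inj lookup_mono)
    then show ?thesis
      using assms(1) \<open>bij h\<close> unfolding symmetric_mpoly_def a_def B_def[symmetric] by metis
  qed
  fix z :: "complex ^ 'n"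
  have "m \<in> range mono" if "m \<in> Poly_Mapping.keys Q" for m
  proof -
    have "Poly_Mapping.lookup m j \<le> 1" for j
      using that assms(2) by (auto simp: multilinear_mpoly_def)
    then have "Poly_Mapping.lookup m j = (if j \<in> Poly_Mapping.keys m then 1 else 0)" for j
      by (metis in_keys_iff le_antisym less_one not_le)
    then have "m = mono (Poly_Mapping.keys m)"
      by (intro poly_mapping_eqI) (simp only: lookup_mono)
    then show ?thesis by blast
  qed
  then have "mpoly_eval Q z = (\<Sum>m\<in>range mono. Poly_Mapping.lookup Q m * (\<Prod>j\<in>UNIV. (z $ j) ^ Poly_Mapping.lookup m j))"
    unfolding mpoly_eval_def by (intro sum.mono_neutral_left) (auto simp: in_keys_iff)
  also have "\<dots> = (\<Sum>A\<in>UNIV. a (card A) * (\<Prod>j\<in>UNIV. (z $ j) ^ (if j \<in> A then 1 else 0)))"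
    by (simp add: sum.reindex[OF inj] lookup_Q lookup_mono)
  also have "\<dots> = symform a UNIV (\<lambda>j. z $ j)"
    unfolding symform_def
    by (intro sum.cong) (auto simp: if_distrib prod.If_cases cong: if_cong)
  finally show "mpoly_eval Q z = symform a UNIV (\<lambda>j. z $ j)" .
qed

section \<open>The gradient of a multiaffine function\<close>

text \<open>\<open>g\<close> is the gradient. The first clause is exact rather than infinitesimal:
  in each coordinate \<open>f\<close> is affine with the partial derivative as slope. The geometric
  lemmas below see the polynomial only through these two clauses.\<close>

definition multiaffine :: "(complex ^ 'n::finite \<Rightarrow> complex) \<Rightarrow> (complex ^ 'n \<Rightarrow> complex ^ 'n) \<Rightarrow> bool" where
  "multiaffine f g \<longleftrightarrow>
     (\<forall>z j s. f (z + axis j s) = f z + s * g z $ j) \<and>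
     (\<forall>z. (f has_derivative (\<lambda>v. \<Sum>j\<in>UNIV. g z $ j * v $ j)) (at z))"

definition symform_grad :: "(nat \<Rightarrow> complex) \<Rightarrow> complex ^ 'n::finite \<Rightarrow> complex ^ 'n" where
  "symform_grad c w = (\<chi> j. \<Sum>A | j \<in> A. c (card A) * (\<Prod>i\<in>A - {j}. w $ i))"

lemma multiaffine_symform:
  fixes p :: "complex ^ 'n::finite"
  shows "multiaffine (\<lambda>z. symform c UNIV (\<lambda>j. (z - p) $ j)) (\<lambda>z. symform_grad c (z - p))"
  unfolding multiaffine_def
proof (intro conjI allI)
  fix z :: "complex ^ 'n" and j s
  have "(\<Prod>i\<in>A. (z + axis j s - p) $ i)
      = (\<Prod>i\<in>A. (z - p) $ i) + (if j \<in> A then s * (\<Prod>i\<in>A - {j}. (z - p) $ i) else 0)" for A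
  proof -
    have eq: "(\<Prod>i\<in>B. (z + axis j s - p) $ i) = (\<Prod>i\<in>B. (z - p) $ i)" if "j \<notin> B" for B
      using that by (intro prod.cong) (auto simp: axis_def)
    show ?thesis
    proof (cases "j \<in> A")
      case True
      then show ?thesis
        by (simp add: prod.remove[of A j] eq) (simp add: axis_def algebra_simps)
    qed (simp add: eq del: vector_add_component vector_minus_component)
  qed
  then have "symform c UNIV (\<lambda>i. (z + axis j s - p) $ i) = symform c UNIV (\<lambda>i. (z - p) $ i)
      + (\<Sum>A\<in>UNIV. if j \<in> A then s * (c (card A) * (\<Prod>i\<in>A - {j}. (z - p) $ i)) else 0)"
    unfolding symform_def Pow_UNIV sum.distrib[symmetric]
    by (intro sum.cong) (auto simp: algebra_simps)
  then show "symform c UNIV (\<lambda>i. (z + axis j s - p) $ i)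
      = symform c UNIV (\<lambda>j. (z - p) $ j) + s * symform_grad c (z - p) $ j"
    by (simp add: symform_grad_def sum_distrib_left sum.If_cases Collect_conj_eq)
next
  fix z :: "complex ^ 'n"
  have "((\<lambda>z. symform c UNIV (\<lambda>j. (z - p) $ j)) has_derivative
      (\<lambda>v. \<Sum>A\<in>UNIV. c (card A) * (\<Sum>j\<in>A. v $ j * (\<Prod>i\<in>A - {j}. (z - p) $ i)))) (at z)"
    unfolding symform_def Pow_UNIV
    by (auto intro!: derivative_eq_intros bounded_linear.has_derivative[OF bounded_linear_vec_nth])
  moreover have "(\<Sum>A\<in>UNIV. c (card A) * (\<Sum>j\<in>A. v $ j * (\<Prod>i\<in>A - {j}. (z - p) $ i)))
      = (\<Sum>j\<in>UNIV. symform_grad c (z - p) $ j * v $ j)" for v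
  proof -
    have "(\<Sum>A\<in>UNIV. c (card A) * (\<Sum>j\<in>A. v $ j * (\<Prod>i\<in>A - {j}. (z - p) $ i)))
        = (\<Sum>A\<in>UNIV. \<Sum>j\<in>UNIV. if j \<in> A then c (card A) * (\<Prod>i\<in>A - {j}. (z - p) $ i) * v $ j else 0)"
      by (intro sum.cong refl) (simp add: sum.If_cases sum_distrib_left mult_ac)
    also have "\<dots> = (\<Sum>j\<in>UNIV. symform_grad c (z - p) $ j * v $ j)"
      by (subst sum.swap) (simp add: symform_grad_def sum_distrib_right sum.If_cases)
    finally show ?thesis .
  qed
  ultimately show "((\<lambda>z. symform c UNIV (\<lambda>j. (z - p) $ j)) has_derivative
      (\<lambda>v. \<Sum>j\<in>UNIV. symform_grad c (z - p) $ j * v $ j)) (at z)"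
    by simp
qed

text \<open>The form starts in degree \<open>m\<close>, but at this point a product over
  \<open>A\<close> survives only if \<open>A\<close> lies in \<open>Y\<close>, which has size
  \<open>m - 1\<close>. In the gradient one factor is dropped, and only the sets
  \<open>insert j Y\<close> with \<open>j\<close> outside \<open>Y\<close> can contribute.\<close>

lemma symform_indicator:
  fixes Y :: "'n::finite set"
  assumes "\<And>k. k < m \<Longrightarrow> c k = 0" "Suc (card Y) = m"
  shows "symform c UNIV (\<lambda>j. if j \<in> Y then t else 0) = 0"
    and "symform_grad c (\<chi> j. if j \<in> Y then t else 0) = (\<chi> j. if j \<in> Y then 0 else c m * t ^ card Y)"
proof -
  let ?w = "\<lambda>j. if j \<in> Y then t else 0"
  have zero: "(\<Prod>i\<in>A. ?w i) = 0" if "\<not> A \<subseteq> Y" for A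
    using that by (intro prod_zero) auto
  have "c (card A) * (\<Prod>i\<in>A. ?w i) = 0" for A
  proof (cases "A \<subseteq> Y")
    case True
    then have "card A < m" using card_mono[of Y A] assms(2) by simp
    then show ?thesis using assms(1) by simp
  qed (simp add: zero)
  then show "symform c UNIV ?w = 0"
    unfolding symform_def by (intro sum.neutral) blast
  have summand: "c (card A) * (\<Prod>i\<in>A - {j}. ?w i)
      = (if j \<notin> Y \<and> A = insert j Y then c m * t ^ card Y else 0)" if "j \<in> A" for A j
  proof (cases "card A < m \<or> \<not> A - {j} \<subseteq> Y")
    case True
    moreover have "card A = m" if "j \<notin> Y" "A = insert j Y"
      using that assms(2) by simp
    ultimately show ?thesis using assms(1) zero[of "A - {j}"] by auto
  next
    case False
    then have "card Y \<le> card (A - {j})" "A - {j} \<subseteq> Y"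
      using that assms(2) by auto
    then have "A - {j} = Y" by (intro card_seteq) auto
    then have "A = insert j Y" "j \<notin> Y" using that by auto
    then show ?thesis using assms(2) by simp
  qed
  have "(\<Sum>A | j \<in> A. c (card A) * (\<Prod>i\<in>A - {j}. ?w i)) = (if j \<in> Y then 0 else c m * t ^ card Y)" for j
  proof -
    have "(\<Sum>A | j \<in> A. c (card A) * (\<Prod>i\<in>A - {j}. ?w i))
        = (\<Sum>A | j \<in> A. if A = insert j Y then if j \<in> Y then 0 else c m * t ^ card Y else 0)"
      by (intro sum.cong) (auto simp: summand)
    then show ?thesis by (simp add: sum.delta)
  qed
  then show "symform_grad c (\<chi> j. ?w j) = (\<chi> j. if j \<in> Y then 0 else c m * t ^ card Y)"
    by (simp add: symform_grad_def vec_eq_iff)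
qed

text \<open>Double counting: each index is left out by \<open>(CARD('n) - 1) choose k\<close> of the
  sets of size \<open>k\<close>, a nonzero number.\<close>

lemma sum_eq_0_if_subset_sums_eq_0:
  fixes v :: "'n::finite \<Rightarrow> 'a::field_char_0"
  assumes "k < CARD('n)" "\<And>Y. card Y = k \<Longrightarrow> (\<Sum>j\<in>- Y. v j) = 0"
  shows "(\<Sum>j\<in>UNIV. v j) = 0"
proof -
  have card: "card {Y. card Y = k \<and> j \<notin> Y} = (CARD('n) - 1) choose k" for j :: 'n
  proof -
    have "{Y. card Y = k \<and> j \<notin> Y} = {Y. Y \<subseteq> UNIV - {j} \<and> card Y = k}" by auto
    then show ?thesis by (simp add: n_subsets card_Diff_singleton)
  qed
  have "0 = (\<Sum>Y | card Y = k. \<Sum>j\<in>- Y. v j)"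
    using assms(2) by simp
  also have "\<dots> = (\<Sum>Y | card Y = k. \<Sum>j\<in>UNIV. if j \<notin> Y then v j else 0)"
    by (rule sum.cong[OF refl], subst sum.If_cases) (auto simp: Compl_eq)
  also have "\<dots> = (\<Sum>j\<in>UNIV. \<Sum>Y | card Y = k. if j \<notin> Y then v j else 0)"
    by (rule sum.swap)
  also have "\<dots> = (\<Sum>j\<in>UNIV. of_nat ((CARD('n) - 1) choose k) * v j)"
    by (intro sum.cong refl) (use card in \<open>simp flip: sum.inter_filter\<close>)
  also have "\<dots> = of_nat ((CARD('n) - 1) choose k) * (\<Sum>j\<in>UNIV. v j)"
    by (simp add: sum_distrib_left)
  finally show ?thesis
    using assms(1) by (simp add: not_less) linarith
qed

section \<open>Smooth curves and complex hyperplanes\<close>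

text \<open>\<open>F\<close> lists successive derivatives. A direction \<open>v\<close> on the real
  line is a scalar, so the induction runs over all multiples of all members of the sequence.\<close>

lemma Ck_on_derivative_sequence:
  fixes F :: "nat \<Rightarrow> real \<Rightarrow> 'a::real_normed_vector"
  assumes U: "open U" and F: "\<And>n t. t \<in> U \<Longrightarrow> (F n has_vector_derivative F (Suc n) t) (at t)"
    and "\<And>t. t \<in> U \<Longrightarrow> f t = c *\<^sub>R F n t"
  shows "Ck_on k U f"
  using assms(3)
proof (induction k arbitrary: f c n)
  case (0 f c n)
  have "continuous_on U (F n)"
    using F by (auto intro!: continuous_at_imp_continuous_on has_vector_derivative_continuous)
  then have "continuous_on U (\<lambda>t. c *\<^sub>R F n t)"
    by (intro continuous_intros)
  then show ?case
    using 0 by (simp cong: continuous_on_cong)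
next
  case (Suc k f c n)
  have deriv: "(f has_vector_derivative c *\<^sub>R F (Suc n) t) (at t)" if "t \<in> U" for t
  proof (rule has_vector_derivative_transform_within_open[OF _ U that])
    show "((\<lambda>t. c *\<^sub>R F n t) has_vector_derivative c *\<^sub>R F (Suc n) t) (at t)"
      using F[OF that, of n] unfolding has_vector_derivative_def
      by (auto intro!: derivative_eq_intros)
  qed (use Suc.prems in auto)
  then have "f differentiable_on U"
    by (auto simp: differentiable_on_def differentiable_def has_vector_derivative_def
        intro: has_derivative_at_withinI)
  moreover have "frechet_derivative f (at t) v = (v * c) *\<^sub>R F (Suc n) t" if "t \<in> U" for t v
    using frechet_derivative_at[OF deriv[OF that, unfolded has_vector_derivative_def], symmetric] by simp
  ultimately show ?case
    using Suc.IH by auto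
qed

lemma has_vector_derivative_vec:
  fixes f :: "'n::finite \<Rightarrow> real \<Rightarrow> 'a::euclidean_space"
  assumes "\<And>i. (f i has_vector_derivative f' i) (at t)"
  shows "((\<lambda>t. \<chi> i. f i t) has_vector_derivative (\<chi> i. f' i)) (at t)"
proof -
  have "((\<lambda>t. f i t \<bullet> b) has_derivative (\<lambda>h. (h *\<^sub>R f' i) \<bullet> b)) (at t)" for i b
    using assms[of i] unfolding has_vector_derivative_def by (rule has_derivative_inner_left)
  then show ?thesis
    unfolding has_vector_derivative_def has_derivative_componentwise_within[of "\<lambda>t. \<chi> i. f i t"]
    by (auto simp: Basis_vec_def inner_axis)
qed

text \<open>On the real axis the complex derivatives of all orders are the successive derivatives of
  the curve.\<close>

lemma smooth_map_on_holomorphic_components: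
  fixes h :: "'n::finite \<Rightarrow> complex \<Rightarrow> complex"
  assumes "\<And>i. h i holomorphic_on ball 0 \<epsilon>"
  shows "smooth_map_on {-\<epsilon><..<\<epsilon>} (\<lambda>t. \<chi> i. h i (of_real t))"
  unfolding smooth_map_on_def
proof
  fix k
  show "Ck_on k {-\<epsilon><..<\<epsilon>} (\<lambda>t. \<chi> i. h i (of_real t))"
  proof (rule Ck_on_derivative_sequence[where F = "\<lambda>n t. \<chi> i. (deriv ^^ n) (h i) (of_real t)" and c = 1 and n = 0])
    fix n and t :: real
    assume t: "t \<in> {-\<epsilon><..<\<epsilon>}"
    show "((\<lambda>t. \<chi> i. (deriv ^^ n) (h i) (of_real t)) has_vector_derivative
        (\<chi> i. (deriv ^^ Suc n) (h i) (of_real t))) (at t)"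
    proof (rule has_vector_derivative_vec)
      fix i
      have "((deriv ^^ n) (h i) has_field_derivative (deriv ^^ Suc n) (h i) (of_real t)) (at (of_real t))"
        using has_field_derivative_higher_deriv[OF assms open_ball, of "of_real t" n i] t by auto
      then show "((\<lambda>t. (deriv ^^ n) (h i) (of_real t)) has_vector_derivative
          (deriv ^^ Suc n) (h i) (of_real t)) (at t)"
        by (rule has_vector_derivative_real_field)
    qed
  qed auto
qed

lemma multiaffine_has_derivative:
  "multiaffine f g \<Longrightarrow> (f has_derivative (\<lambda>v. \<Sum>j\<in>UNIV. g z $ j * v $ j)) (at z)"
  by (simp add: multiaffine_def)

lemma multiaffine_isCont: "multiaffine f g \<Longrightarrow> isCont f z"
  by (meson has_derivative_continuous multiaffine_has_derivative)

lemma multiaffine_add_axis: "multiaffine f g \<Longrightarrow> f (z + axis j s) = f z + s * g z $ j"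
  by (simp add: multiaffine_def)

text \<open>The slope is a difference quotient with step 1, so \<open>g\<close> inherits from
  \<open>f\<close> continuity and differentiability along complex lines.\<close>

lemma multiaffine_grad_eq: "multiaffine f g \<Longrightarrow> g z = (\<chi> j. f (z + axis j 1) - f z)"
  by (simp add: multiaffine_add_axis vec_eq_iff)

lemma multiaffine_grad_isCont:
  assumes "multiaffine f g"
  shows "isCont g z"
proof -
  have "isCont (\<lambda>z. f (z + axis j 1)) z" for j
    using isCont_o2[of z "\<lambda>z. z + axis j 1" f] multiaffine_isCont[OF assms] by simp
  then show ?thesis
    using multiaffine_isCont[OF assms]
    unfolding multiaffine_grad_eq[OF assms, abs_def] isCont_def by (intro tendsto_intros)
qed

lemma multiaffine_line:
  assumes "multiaffine f g"
  shows "((\<lambda>s. f (z + s *s v)) has_field_derivative (\<Sum>j\<in>UNIV. g (z + s *s v) $ j * v $ j)) (at s)"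
proof -
  have "((\<lambda>s. s *s v) has_derivative (\<lambda>h. h *s v)) (at s)"
    by (rule bounded_linear_imp_has_derivative)
      (simp add: linear_conv_bounded_linear[symmetric] linear_iff vec_eq_iff algebra_simps)
  then have "((\<lambda>s. z + s *s v) has_derivative (\<lambda>h. h *s v)) (at s)"
    by (auto intro!: derivative_eq_intros)
  from has_derivative_compose[OF this multiaffine_has_derivative[OF assms]]
  show ?thesis
    unfolding has_field_derivative_def
    by (rule has_derivative_eq_rhs) (simp add: sum_distrib_right sum_distrib_left fun_eq_iff mult_ac)
qed

section \<open>Complex hyperplanes as real subspaces, and their limits\<close>

text \<open>The pairing has no conjugation, in keeping with \<open>log_differential\<close>.\<close>

definition cplx_hyperplane :: "complex ^ 'n::finite \<Rightarrow> (complex ^ 'n) set" where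
  "cplx_hyperplane a = {v. (\<Sum>j\<in>UNIV. a $ j * v $ j) = 0}"

lemma cplx_hyperplane_scale: "c \<noteq> 0 \<Longrightarrow> cplx_hyperplane (c *s a) = cplx_hyperplane a"
  by (simp add: cplx_hyperplane_def mult.assoc flip: sum_distrib_left)

lemma subspace_cplx_hyperplane: "subspace (cplx_hyperplane a)"
  by (auto simp: subspace_def cplx_hyperplane_def distrib_left sum.distrib simp flip: scaleR_sum_right)

lemma dist_le_if_orthogonal:
  assumes "(v - w) \<bullet> (w - z) = 0"
  shows "dist v w \<le> dist v z"
proof -
  have "(norm (v - z))\<^sup>2 = (norm (v - w))\<^sup>2 + (norm (w - z))\<^sup>2"
    using norm_add_Pythagorean[of "v - w" "w - z"] assms by (simp add: orthogonal_def)
  then have "(norm (v - w))\<^sup>2 \<le> (norm (v - z))\<^sup>2" by simp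
  then show ?thesis by (simp add: dist_norm power2_le_iff_abs_le)
qed

text \<open>Being annihilated by \<open>a\<close> is Hermitian orthogonality to the conjugate of
  \<open>a\<close>, so the projection removes the component along that conjugate.\<close>

lemma closest_point_cplx_hyperplane:
  fixes a v :: "complex ^ 'n::finite"
  assumes "a \<noteq> 0"
  shows "closest_point (cplx_hyperplane a) v
    = v - (\<chi> i. (\<Sum>j\<in>UNIV. a $ j * v $ j) / (\<Sum>j\<in>UNIV. a $ j * cnj (a $ j)) * cnj (a $ i))"
    (is "_ = ?w")
proof (rule sym, rule closest_point_unique)
  let ?N = "\<Sum>j\<in>UNIV. a $ j * cnj (a $ j)"
  have "?N = of_real (\<Sum>j\<in>UNIV. (cmod (a $ j))\<^sup>2)"
    by (simp add: complex_norm_square del: of_real_power)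
  moreover obtain i where "a $ i \<noteq> 0" using assms by (auto simp: vec_eq_iff)
  then have "(\<Sum>j\<in>UNIV. (cmod (a $ j))\<^sup>2) > 0"
    by (intro sum_pos2[of _ i]) auto
  ultimately have "?N \<noteq> 0" by (metis of_real_eq_0_iff less_irrefl)
  then show w: "?w \<in> cplx_hyperplane a"
    by (simp add: cplx_hyperplane_def right_diff_distrib sum_subtractf mult.left_commute[of "a $ _"]
        flip: sum_distrib_left sum_divide_distrib)
  show "\<forall>z\<in>cplx_hyperplane a. dist v ?w \<le> dist v z"
  proof
    fix z assume "z \<in> cplx_hyperplane a"
    then have "?w - z \<in> cplx_hyperplane a"
      using w subspace_diff[OF subspace_cplx_hyperplane] by blast
    then have 0: "(\<Sum>j\<in>UNIV. a $ j * (?w - z) $ j) = 0"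
      by (simp only: cplx_hyperplane_def mem_Collect_eq)
    define \<mu> where "\<mu> = (\<Sum>j\<in>UNIV. a $ j * v $ j) / ?N"
    \<comment> \<open>The real inner product is the real part of the Hermitian one. As
      \<open>v - ?w\<close> is \<mu> times the conjugate of \<open>a\<close>, the bilinear pairing
      with \<open>a\<close> reappears, and it vanishes by \<open>0\<close>.\<close>
    have "(v - ?w) \<bullet> (?w - z) = (\<Sum>j\<in>UNIV. (\<mu> * cnj (a $ j)) \<bullet> ((?w - z) $ j))"
      by (simp only: inner_vec_def) (simp add: \<mu>_def)
    also have "\<dots> = (\<Sum>j\<in>UNIV. Re (cnj \<mu> * (a $ j * (?w - z) $ j)))"
      by (intro sum.cong refl) (simp add: inner_complex_def algebra_simps del: vector_minus_component)
    also have "\<dots> = Re (cnj \<mu> * (\<Sum>j\<in>UNIV. a $ j * (?w - z) $ j))"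
      by (simp only: sum_distrib_left Re_sum)
    finally have "(v - ?w) \<bullet> (?w - z) = 0"
      by (simp only: 0 mult_zero_right zero_complex.sel)
    then show "dist v ?w \<le> dist v z"
      by (rule dist_le_if_orthogonal)
  qed
qed (use subspace_cplx_hyperplane in \<open>auto intro: subspace_imp_convex closed_subspace\<close>)

text \<open>The projection formula is continuous in the normal vector away from 0.\<close>

lemma subspaces_tendsto_cplx_hyperplane:
  fixes a :: "nat \<Rightarrow> complex ^ 'n::finite"
  assumes "a \<longlonglongrightarrow> b" "b \<noteq> 0" "\<And>n. a n \<noteq> 0"
  shows "subspaces_tendsto (\<lambda>n. cplx_hyperplane (a n)) (cplx_hyperplane b)"
proof -
  have "(\<Sum>j\<in>UNIV. b $ j * cnj (b $ j)) \<noteq> 0"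
  proof -
    have "(\<Sum>j\<in>UNIV. b $ j * cnj (b $ j)) = of_real (b \<bullet> b)"
      by (simp add: inner_vec_def complex_norm_square power2_norm_eq_inner[symmetric] del: of_real_power)
    then show ?thesis using assms(2) by simp
  qed
  then show ?thesis
    using assms unfolding subspaces_tendsto_def
    by (auto simp: subspace_cplx_hyperplane closest_point_cplx_hyperplane intro!: tendsto_intros)
qed

lemma cplx_hyperplane_tendsto_mem:
  assumes "a \<longlonglongrightarrow> b" "w \<longlonglongrightarrow> v" "\<forall>\<^sub>F n in sequentially. w n \<in> cplx_hyperplane (a n)"
  shows "v \<in> cplx_hyperplane b"
proof -
  have "(\<lambda>n. \<Sum>j\<in>UNIV. a n $ j * w n $ j) \<longlonglongrightarrow> (\<Sum>j\<in>UNIV. b $ j * v $ j)"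
    using assms(1,2) by (intro tendsto_intros)
  moreover have "(\<lambda>n. \<Sum>j\<in>UNIV. a n $ j * w n $ j) \<longlonglongrightarrow> 0"
    by (rule tendsto_eventually) (use assms(3) in \<open>simp add: cplx_hyperplane_def\<close>)
  ultimately show ?thesis
    by (simp add: cplx_hyperplane_def LIMSEQ_unique)
qed

lemma velocity_in_cplx_hyperplane:
  assumes "multiaffine f g" "\<epsilon> > 0" "\<And>t. \<bar>t\<bar> < \<epsilon> \<Longrightarrow> f (\<gamma> t) = 0"
    and "(\<gamma> has_vector_derivative v) (at 0)"
  shows "v \<in> cplx_hyperplane (g (\<gamma> 0))"
proof -
  have "((\<lambda>t. f (\<gamma> t)) has_derivative (\<lambda>h. \<Sum>j\<in>UNIV. g (\<gamma> 0) $ j * (h *\<^sub>R v) $ j)) (at 0)"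
    using assms(4) multiaffine_has_derivative[OF assms(1)]
    unfolding has_vector_derivative_def by (rule has_derivative_compose)
  moreover have "((\<lambda>t. f (\<gamma> t)) has_derivative (\<lambda>h. 0)) (at 0)"
  proof (rule has_derivative_transform_within_open[of "\<lambda>_. 0" _ _ _ "{-\<epsilon><..<\<epsilon>}"])
    show "0 = f (\<gamma> t)" if "t \<in> {-\<epsilon><..<\<epsilon>}" for t
      using that assms(3)[of t] by (simp add: abs_less_iff)
  qed (use assms(2) in auto)
  ultimately have "(\<lambda>h. \<Sum>j\<in>UNIV. g (\<gamma> 0) $ j * (h *\<^sub>R v) $ j) = (\<lambda>h. 0)"
    by (rule has_derivative_unique)
  then have "(\<Sum>j\<in>UNIV. g (\<gamma> 0) $ j * (1 *\<^sub>R v) $ j) = 0"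
    by meson
  then show ?thesis by (simp add: cplx_hyperplane_def)
qed

section \<open>Tangent spaces of submanifolds\<close>

lemma cplx_hyperplane_subset_tangent_space:
  fixes R :: "(complex ^ 'n::finite) set"
  assumes fg: "multiaffine f g" and "open G" "x \<in> G" "f x = 0" "g x \<noteq> 0"
    and R: "\<And>z. z \<in> G \<Longrightarrow> f z = 0 \<Longrightarrow> z \<in> R"
  shows "cplx_hyperplane (g x) \<subseteq> tangent_space R x"
proof
  fix v assume v: "v \<in> cplx_hyperplane (g x)"
  obtain j where j: "g x $ j \<noteq> 0"
    using assms(5) by (auto simp: vec_eq_iff)
  \<comment> \<open>Since f is affine in the j-th coordinate, the line through x with direction v can be pushed
    into the zero set along that coordinate by an explicit correction u, which is of second order.\<close>
  define L where "L = (\<lambda>s. x + s *s v)"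
  define B where "B = (\<lambda>s. g (L s) $ j)"
  define u where "u = (\<lambda>s. - f (L s) / B s)"
  define h where "h = (\<lambda>i s. L s $ i + (if i = j then u s else 0))"
  have f_L: "((\<lambda>s. f (L s)) has_field_derivative (\<Sum>i\<in>UNIV. g (L s) $ i * v $ i)) (at s)" for s
    unfolding L_def by (rule multiaffine_line[OF fg])
  \<comment> \<open>As a difference of \<open>f\<close> along two parallel lines, \<open>B\<close>
    is complex differentiable.\<close>
  have "B = (\<lambda>s. f (x + axis j 1 + s *s v) - f (L s))"
    by (simp add: B_def L_def multiaffine_grad_eq[OF fg] algebra_simps)
  then have "\<exists>D. (B has_field_derivative D) (at s)" for s
    using DERIV_diff[OF multiaffine_line[OF fg, of "x + axis j 1" v s] f_L] by auto
  then obtain B' where B': "(B has_field_derivative B' s) (at s)" for s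
    by metis
  have [simp]: "L 0 = x" by (simp add: L_def)
  have "B 0 \<noteq> 0" using j by (simp add: B_def)
  have "f (L 0) = 0" using assms(4) by simp
  have u': "(u has_field_derivative
      (- (\<Sum>i\<in>UNIV. g (L s) $ i * v $ i) * B s + f (L s) * B' s) / (B s * B s)) (at s)" if "B s \<noteq> 0" for s
    using DERIV_divide[OF DERIV_minus[OF f_L] B' that] unfolding u_def by simp
  \<comment> \<open>Both terms of the numerator vanish at 0, since \<open>v\<close> annihilates the
    gradient and \<open>f x = 0\<close>. The correction therefore leaves the velocity
    unchanged.\<close>
  have u0: "(u has_field_derivative 0) (at 0)"
    using u'[OF \<open>B 0 \<noteq> 0\<close>] v \<open>f (L 0) = 0\<close> by (simp add: cplx_hyperplane_def)
  have "isCont B 0"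
    using B' by (rule DERIV_isCont)
  then have "\<forall>\<^sub>F s in nhds 0. B s \<noteq> 0"
    using \<open>B 0 \<noteq> 0\<close> unfolding isCont_def eventually_nhds_conv_at
    by (auto intro: tendsto_imp_eventually_ne)
  moreover have h': "(h i has_field_derivative v $ i) (at 0)" for i
    unfolding h_def L_def using u0 by (cases "i = j") (auto intro!: derivative_eq_intros)
  have "isCont (\<lambda>s. \<chi> i. h i s) 0"
    using DERIV_isCont[OF h'] unfolding isCont_def by (intro tendsto_intros)
  moreover have "(\<chi> i. h i 0) = x"
    using \<open>f (L 0) = 0\<close> by (simp add: h_def u_def vec_eq_iff)
  ultimately have "\<forall>\<^sub>F s in nhds 0. B s \<noteq> 0 \<and> (\<chi> i. h i s) \<in> G"
    using \<open>open G\<close> \<open>x \<in> G\<close>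
    by (simp add: eventually_conj_iff isCont_def tendsto_def eventually_nhds_conv_at)
  then obtain \<epsilon> where \<epsilon>: "\<epsilon> > 0" "\<And>s. s \<in> ball 0 \<epsilon> \<Longrightarrow> B s \<noteq> 0" "\<And>s. s \<in> ball 0 \<epsilon> \<Longrightarrow> (\<chi> i. h i s) \<in> G"
    unfolding eventually_nhds_metric by (auto simp: dist_commute)
  have "h i holomorphic_on ball 0 \<epsilon>" for i
  proof -
    have "u holomorphic_on ball 0 \<epsilon>"
      using u' \<epsilon>(2) by (intro holomorphic_onI) (metis DERIV_subset field_differentiable_def field_differentiable_at_within)
    then show ?thesis
      unfolding h_def L_def by (cases "i = j") (auto intro!: holomorphic_intros)
  qed
  then have "smooth_map_on {-\<epsilon><..<\<epsilon>} (\<lambda>t. \<chi> i. h i (of_real t))"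
    by (rule smooth_map_on_holomorphic_components)
  moreover have "(\<chi> i. h i (of_real t)) \<in> R" if "t \<in> {-\<epsilon><..<\<epsilon>}" for t
  proof (rule R)
    have t: "complex_of_real t \<in> ball 0 \<epsilon>" using that by (auto simp: dist_norm)
    then show "(\<chi> i. h i (of_real t)) \<in> G" by (rule \<epsilon>)
    have "(\<chi> i. h i (of_real t)) = L (of_real t) + axis j (u (of_real t))"
      by (simp add: h_def vec_eq_iff axis_def)
    then show "f (\<chi> i. h i (of_real t)) = 0"
      using \<epsilon>(2)[OF t] by (simp add: multiaffine_add_axis[OF fg] u_def B_def)
  qed
  moreover have "((\<lambda>t. \<chi> i. h i (of_real t)) has_vector_derivative (\<chi> i. v $ i)) (at 0)"
    using h' by (intro has_vector_derivative_vec has_vector_derivative_real_field) simp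
  ultimately show "v \<in> tangent_space R x"
    using \<epsilon>(1) \<open>(\<chi> i. h i 0) = x\<close> unfolding tangent_space_def
    by (auto intro!: exI[of _ "\<lambda>t. \<chi> i. h i (of_real t)"] exI[of _ \<epsilon>])
qed

text \<open>Curves in \<open>R\<close> stay in the zero set, so the gradient kills their velocities.
  Conversely \<open>R\<close> fills the zero set near \<open>x\<close>, so the curves constructed
  above lie in \<open>R\<close>.\<close>

lemma tangent_space_eq_cplx_hyperplane:
  fixes R :: "(complex ^ 'n::finite) set"
  assumes "multiaffine f g" "open G" "x \<in> G" "f x = 0" "g x \<noteq> 0"
    and "R \<subseteq> {z. f z = 0}" "{z. f z = 0} \<inter> G \<subseteq> R"
  shows "tangent_space R x = cplx_hyperplane (g x)"
proof
  show "cplx_hyperplane (g x) \<subseteq> tangent_space R x"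
    using assms by (intro cplx_hyperplane_subset_tangent_space[OF assms(1-5)]) auto
  show "tangent_space R x \<subseteq> cplx_hyperplane (g x)"
  proof
    fix v assume "v \<in> tangent_space R x"
    then obtain \<gamma> \<epsilon> where *: "\<epsilon> > 0" "\<gamma> ` {-\<epsilon><..<\<epsilon>} \<subseteq> R" "\<gamma> 0 = x"
        "(\<gamma> has_vector_derivative v) (at (0::real))"
      unfolding tangent_space_def by auto
    have "f (\<gamma> t) = 0" if "\<bar>t\<bar> < \<epsilon>" for t
      using that *(2) assms(6) by (auto simp: abs_less_iff image_subset_iff)
    then show "v \<in> cplx_hyperplane (g x)"
      using velocity_in_cplx_hyperplane[OF assms(1) *(1) _ *(4)] *(3) by auto
  qed
qed

section \<open>Strata with interior in the variety\<close>

text \<open>A chart flattens \<open>S\<close> to a piece of a linear subspace, which is closed, so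
  limits inside the chart domain stay in \<open>S\<close>.\<close>

lemma smooth_submanifold_locally_closed:
  assumes "smooth_submanifold k S" "x \<in> S"
  obtains U where "open U" "x \<in> U" "closure S \<inter> U \<subseteq> S"
proof -
  obtain U W \<phi> \<psi> and L :: "'a set" where *: "open U" "x \<in> U" "homeomorphism U W \<phi> \<psi>"
      "subspace L" "\<phi> ` (S \<inter> U) = L \<inter> W"
    using assms unfolding smooth_submanifold_def by meson
  have "z \<in> S" if z: "z \<in> closure S" "z \<in> U" for z
  proof -
    have "z \<in> closure (S \<inter> U)"
      using open_Int_closure_subset[OF *(1), of S] z by (auto simp: Int_commute)
    then obtain s where s: "\<And>n. s n \<in> S \<inter> U" "s \<longlonglongrightarrow> z"
      unfolding closure_sequential by blast
    have "isCont \<phi> z"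
      using *(1,3) z by (auto simp: homeomorphism_def continuous_on_eq_continuous_at)
    then have "(\<lambda>n. \<phi> (s n)) \<longlonglongrightarrow> \<phi> z"
      using s(2) isCont_tendsto_compose by blast
    moreover have "\<phi> (s n) \<in> L" for n
      using s(1) *(5) by blast
    ultimately have "\<phi> z \<in> L"
      using Lim_in_closed_set[OF closed_subspace[OF *(4)], of "\<lambda>n. \<phi> (s n)" sequentially] by simp
    then have "\<phi> z \<in> \<phi> ` (S \<inter> U)"
      using *(3,5) z by (auto simp: homeomorphism_def)
    then obtain y where "y \<in> S" "y \<in> U" "\<phi> z = \<phi> y" by blast
    then have "z = y"
      using *(3) z by (metis homeomorphism_apply1)
    then show ?thesis using \<open>y \<in> S\<close> by simp
  qed
  then show thesis
    using * that by blast
qed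

text \<open>Baire's theorem for finitely many sets: if \<open>V \<inter> G\<close> is not inside
  \<open>C\<close>, then \<open>G - C\<close> is open, still meets \<open>V\<close>, and there the
  other sets cover \<open>V\<close>.\<close>

lemma finite_closed_cover_interior:
  assumes "finite F" "\<And>C. C \<in> F \<Longrightarrow> closed C" "open G" "V \<inter> G \<noteq> {}" "V \<inter> G \<subseteq> \<Union>F"
  shows "\<exists>C\<in>F. \<exists>G'. open G' \<and> G' \<subseteq> G \<and> V \<inter> G' \<noteq> {} \<and> V \<inter> G' \<subseteq> C"
  using assms
proof (induction F arbitrary: G)
  case (insert C F)
  show ?case
  proof (cases "V \<inter> G \<subseteq> C")
    case False
    then have "\<exists>D\<in>F. \<exists>G'. open G' \<and> G' \<subseteq> G - C \<and> V \<inter> G' \<noteq> {} \<and> V \<inter> G' \<subseteq> D"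
      using insert.prems by (intro insert.IH) auto
    then show ?thesis by blast
  qed (use insert.prems in blast)
qed auto

text \<open>Strata need not be closed, so the covering argument runs with closures. Local closedness
  at a point of \<open>R\<close> then leads back from \<open>closure R\<close> to
  \<open>R\<close>.\<close>

lemma finite_smooth_cover_interior:
  assumes "finite F" "\<forall>R\<in>F. \<exists>k. smooth_submanifold k R"
    and "open G" "V \<inter> G \<noteq> {}" "V \<inter> G \<subseteq> \<Union>F"
  obtains R G' x where "R \<in> F" "open G'" "G' \<subseteq> G" "x \<in> R \<inter> G'" "V \<inter> G' \<subseteq> R"
proof -
  have "\<Union>F \<subseteq> \<Union>(closure ` F)"
    using closure_subset by blast
  with assms(5) have "V \<inter> G \<subseteq> \<Union>(closure ` F)"
    by (rule subset_trans)
  then obtain R G' where R: "R \<in> F" "open G'" "G' \<subseteq> G" "V \<inter> G' \<noteq> {}" "V \<inter> G' \<subseteq> closure R"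
    using finite_closed_cover_interior[of "closure ` F" G V] assms(1,3,4) by blast
  then obtain x where x: "x \<in> R" "x \<in> G'"
    using open_Int_closure_eq_empty[of G' R] by blast
  obtain U where "open U" "x \<in> U" "closure R \<inter> U \<subseteq> R"
    using assms(2) R(1) smooth_submanifold_locally_closed[OF _ x(1)] by blast
  then show thesis
    using R x that[of R "G' \<inter> U" x] by blast
qed

section \<open>Moving a tangent vector along its stratum\<close>

lemma has_vector_derivative_quotient:
  assumes "(f has_vector_derivative u) (at 0)"
  shows "((\<lambda>t. (f t - f 0) /\<^sub>R t) \<longlongrightarrow> u) (at 0)"
proof -
  have "((\<lambda>t. norm (f t - f 0 - t *\<^sub>R u) / norm t) \<longlongrightarrow> 0) (at 0)"
    using assms unfolding has_vector_derivative_def has_derivative_at by simp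
  moreover have "\<forall>\<^sub>F t in at 0. norm (f t - f 0 - t *\<^sub>R u) / norm t = norm ((f t - f 0) /\<^sub>R t - u)"
  proof (rule eventually_mono[OF eventually_neq_at_within[of 0]])
    fix t :: real assume "t \<noteq> 0"
    then have "(f t - f 0) /\<^sub>R t - u = (f t - f 0 - t *\<^sub>R u) /\<^sub>R t"
      by (simp add: algebra_simps)
    then show "norm (f t - f 0 - t *\<^sub>R u) / norm t = norm ((f t - f 0) /\<^sub>R t - u)"
      by (simp add: divide_inverse mult.commute)
  qed
  ultimately have "((\<lambda>t. norm ((f t - f 0) /\<^sub>R t - u)) \<longlongrightarrow> 0) (at 0)"
    by (simp add: filterlim_cong)
  then show ?thesis
    by (simp only: tendsto_norm_zero_iff LIM_zero_iff)
qed

text \<open>In a chart \<open>v\<close> becomes a vector \<open>u\<close> of the model subspace.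
  Pulling the same \<open>u\<close> back at the images of the points \<open>x n\<close> gives
  velocities that tend to \<open>v\<close>, because the derivative of \<psi> is continuous.\<close>

lemma smooth_submanifold_tangent_extension:
  fixes S :: "'a::euclidean_space set"
  assumes "smooth_submanifold k S" "p \<in> S" "v \<in> tangent_space S p"
    and "x \<longlonglongrightarrow> p" "\<And>n. x n \<in> S"
  obtains w where "w \<longlonglongrightarrow> v"
    and "\<forall>\<^sub>F n in sequentially. \<exists>\<gamma> \<epsilon>. \<epsilon> > 0 \<and> (\<forall>t. \<bar>t\<bar> < \<epsilon> \<longrightarrow> \<gamma> t \<in> S) \<and> \<gamma> 0 = x n \<and>
      (\<gamma> has_vector_derivative w n) (at (0::real))"
proof -
  obtain U W \<phi> \<psi> and L :: "'a set" where U: "open U" "p \<in> U" "open W" and hom: "homeomorphism U W \<phi> \<psi>"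
      and smooth: "smooth_map_on U \<phi>" "smooth_map_on W \<psi>"
      and L: "subspace L" "\<phi> ` (S \<inter> U) = L \<inter> W"
    using assms(1,2) unfolding smooth_submanifold_def by meson
  obtain \<gamma> \<epsilon> where \<gamma>: "\<epsilon> > 0" "\<gamma> ` {-\<epsilon><..<\<epsilon>} \<subseteq> S" "\<gamma> 0 = p" "(\<gamma> has_vector_derivative v) (at (0::real))"
    using assms(3) unfolding tangent_space_def by auto
  have \<phi>W: "\<phi> z \<in> W" and \<psi>\<phi>: "\<psi> (\<phi> z) = z" if "z \<in> U" for z
    using hom that by (auto simp: homeomorphism_def)
  have D\<phi>: "(\<phi> has_derivative frechet_derivative \<phi> (at z)) (at z)" if "z \<in> U" for z
    using smooth(1)[unfolded smooth_map_on_def, rule_format, of "Suc 0"] U(1) that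
    by (simp add: differentiable_on_eq_differentiable_at frechet_derivative_works)
  have D\<psi>: "(\<psi> has_derivative frechet_derivative \<psi> (at z)) (at z)" if "z \<in> W" for z
    using smooth(2)[unfolded smooth_map_on_def, rule_format, of "Suc 0"] U(3) that
    by (simp add: differentiable_on_eq_differentiable_at frechet_derivative_works)
  have D\<psi>_cont: "isCont (\<lambda>y. frechet_derivative \<psi> (at y) e) z" if "z \<in> W" for z e
    using smooth(2)[unfolded smooth_map_on_def, rule_format, of "Suc 0"] U(3) that
    by (simp add: continuous_on_eq_continuous_at)
  have \<phi>_cont: "isCont \<phi> p"
    using D\<phi>[OF U(2)] has_derivative_continuous by blast
  define u where "u = frechet_derivative \<phi> (at p) v"
  define w where "w = (\<lambda>n. frechet_derivative \<psi> (at (\<phi> (x n))) u)"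
  \<comment> \<open>\<open>u\<close> is a limit of difference quotients that lie in the closed
    subspace \<open>L\<close>.\<close>
  have "u \<in> L"
  proof -
    have "((\<lambda>t. \<phi> (\<gamma> t)) has_derivative (\<lambda>h. frechet_derivative \<phi> (at p) (h *\<^sub>R v))) (at 0)"
      using \<gamma>(3,4) D\<phi>[OF U(2)] unfolding has_vector_derivative_def by (metis has_derivative_compose)
    then have "((\<lambda>t. \<phi> (\<gamma> t)) has_vector_derivative u) (at 0)"
      using D\<phi>[OF U(2), THEN has_derivative_linear]
      unfolding has_vector_derivative_def u_def by (simp add: linear_cmul)
    then have "((\<lambda>t. (\<phi> (\<gamma> t) - \<phi> (\<gamma> 0)) /\<^sub>R t) \<longlongrightarrow> u) (at 0)"
      by (rule has_vector_derivative_quotient)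
    moreover have "\<forall>\<^sub>F t in at 0. (\<phi> (\<gamma> t) - \<phi> (\<gamma> 0)) /\<^sub>R t \<in> L"
    proof -
      have "isCont \<gamma> 0"
        using \<gamma>(4) by (rule has_vector_derivative_continuous)
      then have "\<forall>\<^sub>F t in at 0. \<gamma> t \<in> U"
        using U \<gamma>(3) by (simp add: isCont_def tendsto_def)
      moreover have "\<forall>\<^sub>F t in at 0. t \<in> {-\<epsilon><..<\<epsilon>}"
        using \<gamma>(1) by (intro eventually_at_in_open') auto
      ultimately show ?thesis
      proof eventually_elim
        case (elim t)
        then have "\<phi> (\<gamma> t) \<in> L" "\<phi> (\<gamma> 0) \<in> L"
          using \<gamma>(2,3) L(2) assms(2) U(2) by blast+
        then show ?case
          using L(1) by (intro subspace_scale subspace_diff)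
      qed
    qed
    ultimately show ?thesis
      using closed_subspace[OF L(1)] by (intro Lim_in_closed_set[of L]) auto
  qed
  have "(\<lambda>n. \<phi> (x n)) \<longlonglongrightarrow> \<phi> p"
    using \<phi>_cont assms(4) by (rule isCont_tendsto_compose)
  then have "w \<longlonglongrightarrow> frechet_derivative \<psi> (at (\<phi> p)) u"
    unfolding w_def by (rule isCont_tendsto_compose[OF D\<psi>_cont[OF \<phi>W[OF U(2)]]])
  moreover have "frechet_derivative \<psi> (at (\<phi> p)) u = v"
  proof -
    have "((\<lambda>z. \<psi> (\<phi> z)) has_derivative
        (\<lambda>h. frechet_derivative \<psi> (at (\<phi> p)) (frechet_derivative \<phi> (at p) h))) (at p)"
      using D\<phi>[OF U(2)] D\<psi>[OF \<phi>W[OF U(2)]] by (rule has_derivative_compose)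
    moreover have "((\<lambda>z. \<psi> (\<phi> z)) has_derivative (\<lambda>h. h)) (at p)"
      by (rule has_derivative_transform_within_open[OF has_derivative_ident U(1,2)]) (simp add: \<psi>\<phi>)
    ultimately have "(\<lambda>h. frechet_derivative \<psi> (at (\<phi> p)) (frechet_derivative \<phi> (at p) h)) = (\<lambda>h. h)"
      by (rule has_derivative_unique)
    then show ?thesis unfolding u_def by meson
  qed
  moreover have "\<forall>\<^sub>F n in sequentially. \<exists>\<gamma> \<epsilon>. \<epsilon> > 0 \<and> (\<forall>t. \<bar>t\<bar> < \<epsilon> \<longrightarrow> \<gamma> t \<in> S) \<and> \<gamma> 0 = x n \<and>
      (\<gamma> has_vector_derivative w n) (at (0::real))"
  proof -
    have "\<forall>\<^sub>F n in sequentially. x n \<in> U"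
      using assms(4) U(1,2) by (rule topological_tendstoD)
    then show ?thesis
    proof eventually_elim
      case (elim n)
      \<comment> \<open>A straight segment in the model subspace; \<psi> bends it into a curve in
        \<open>S\<close> through \<open>x n\<close>.\<close>
      define \<beta> where "\<beta> = (\<lambda>t. \<phi> (x n) + t *\<^sub>R u)"
      have \<beta>: "(\<beta> has_derivative (\<lambda>t. t *\<^sub>R u)) (at 0)"
        unfolding \<beta>_def by (auto intro!: derivative_eq_intros)
      have "\<forall>\<^sub>F t in nhds 0. \<beta> t \<in> W"
        using has_derivative_continuous[OF \<beta>] U(3) \<phi>W[OF elim]
        by (simp add: isCont_def tendsto_def eventually_nhds_conv_at \<beta>_def)
      then obtain \<delta> where \<delta>: "\<delta> > 0" "\<And>t. \<bar>t\<bar> < \<delta> \<Longrightarrow> \<beta> t \<in> W"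
        unfolding eventually_nhds_metric by auto
      have "\<psi> (\<beta> t) \<in> S" if "\<bar>t\<bar> < \<delta>" for t
      proof -
        have "\<phi> (x n) \<in> L" using elim assms(5) L(2) by blast
        then have "\<beta> t \<in> L"
          unfolding \<beta>_def using \<open>u \<in> L\<close> L(1) by (intro subspace_add subspace_scale)
        then have "\<beta> t \<in> \<phi> ` (S \<inter> U)" using \<delta>(2)[OF that] L(2) by blast
        then show ?thesis using \<psi>\<phi> by auto
      qed
      moreover have "\<psi> (\<beta> 0) = x n" using \<psi>\<phi>[OF elim] by (simp add: \<beta>_def)
      moreover have "((\<lambda>t. \<psi> (\<beta> t)) has_vector_derivative w n) (at 0)"
      proof -
        have D: "(\<psi> has_derivative frechet_derivative \<psi> (at (\<phi> (x n)))) (at (\<beta> 0))"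
          using D\<psi>[OF \<phi>W[OF elim]] by (simp add: \<beta>_def)
        show ?thesis
          using has_derivative_compose[OF \<beta> D] has_derivative_linear[OF D]
          unfolding has_vector_derivative_def w_def by (simp add: linear_cmul)
      qed
      ultimately show ?case
        using \<delta>(1) by (intro exI[of _ "\<lambda>t. \<psi> (\<beta> t)"] exI[of _ \<delta>]) auto
    qed
  qed
  ultimately show thesis
    using that by simp
qed

section \<open>Limits of tangent hyperplanes\<close>

text \<open>If every member of \<open>F\<close> failed at some index, all would fail at the largest
  of these indices.\<close>

lemma finite_antimono_pigeonhole:
  assumes "finite F" "\<And>n::nat. \<exists>R\<in>F. P n R" "\<And>m n R. m \<le> n \<Longrightarrow> P n R \<Longrightarrow> P m R"
  shows "\<exists>R\<in>F. \<forall>n. P n R"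
proof (rule ccontr)
  assume "\<not> ?thesis"
  then have "\<forall>R\<in>F. \<exists>n. \<not> P n R" by blast
  then obtain N where N: "\<forall>R\<in>F. \<not> P (N R) R"
    by (rule bchoice[THEN exE])
  obtain R where "R \<in> F" "P (Max (N ` F)) R" using assms(2) by blast
  moreover have "N R \<le> Max (N ` F)" using assms(1) \<open>R \<in> F\<close> by simp
  ultimately show False using N assms(3) by blast
qed

text \<open>Arbitrarily close to \<open>p\<close>, some stratum has interior in the zero set, and there its tangent
  spaces are the kernels of the gradient. Condition (a) therefore puts the tangent space of the
  stratum of \<open>p\<close> into every limit of such kernels.\<close>

lemma whitney_tangent_space_subset:
  fixes f :: "complex ^ 'n::finite \<Rightarrow> complex"
  assumes whitney: "whitney_stratification {z. f z = 0} \<S>" and fg: "multiaffine f g"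
    and S: "S \<in> \<S>" "p \<in> S" and "b \<noteq> 0"
    and near: "\<And>e. e > 0 \<Longrightarrow> \<exists>q c. f q = 0 \<and> dist q p < e \<and> c \<noteq> 0 \<and> g q = c *s b"
  shows "tangent_space S p \<subseteq> cplx_hyperplane b"
proof -
  let ?V = "{z. f z = 0}"
  note w = whitney[unfolded whitney_stratification_def]
  have part: "\<Union>\<S> = ?V"
    using w[THEN conjunct1] by (simp only: partition_on_def)
  note loc_finite = w[THEN conjunct2, THEN conjunct1]
    and smooth = w[THEN conjunct2, THEN conjunct2, THEN conjunct1, rule_format]
    and frontier = w[THEN conjunct2, THEN conjunct2, THEN conjunct2, THEN conjunct1, rule_format]
    and cond_a = w[THEN conjunct2, THEN conjunct2, THEN conjunct2, THEN conjunct2, rule_format,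
      THEN conjunct1]
  have "p \<in> ?V" using S part by blast
  \<comment> \<open>By local finiteness only finitely many strata come near \<open>p\<close>; both
    the covering argument and the pigeonhole principle rely on this.\<close>
  then obtain N where N: "openin (top_of_set ?V) N" "p \<in> N" "finite {R \<in> \<S>. R \<inter> N \<noteq> {}}"
    using loc_finite unfolding locally_finite_in_def topspace_euclidean_subtopology by blast
  define F where "F = {R \<in> \<S>. R \<inter> N \<noteq> {}}"
  have "finite F" and smooth_F: "\<forall>R\<in>F. \<exists>k. smooth_submanifold k R"
    using N(3) smooth by (simp_all add: F_def)
  obtain O' where O': "open O'" "N = ?V \<inter> O'"
    using N(1) by (auto simp: openin_open)
  \<comment> \<open>Only the direction of the gradient is controlled, so it is rescaled by
    \<open>c\<close> before being compared with \<open>b\<close>.\<close>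
  define P where "P = (\<lambda>n R. \<exists>x\<in>R. dist x p < 1 / Suc n \<and> (\<exists>c. c \<noteq> 0 \<and> dist (c *s g x) b < 1 / Suc n) \<and>
      g x \<noteq> 0 \<and> tangent_space R x = cplx_hyperplane (g x))"
  have "\<exists>R\<in>F. P n R" for n
  proof -
    obtain \<delta> where \<delta>: "\<delta> > 0" "ball p \<delta> \<subseteq> O'"
      using O' N(2) openE by (metis IntD2)
    then obtain q c where q: "f q = 0" "dist q p < min \<delta> (1 / Suc n)" "c \<noteq> 0" "g q = c *s b"
      using near[of "min \<delta> (1 / Suc n)"] by auto
    \<comment> \<open>\<delta> keeps the zeros in \<open>G\<close> inside \<open>N\<close>, and the
      bound \<open>norm b\<close> keeps the rescaled gradient away from 0.\<close>
    define G where "G = ball p (min \<delta> (1 / Suc n)) \<inter> (\<lambda>z. (1/c) *s g z) -` ball b (min (norm b) (1 / Suc n))"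
    have "isCont (\<lambda>z. (1/c) *s g z) z" for z
      using multiaffine_grad_isCont[OF fg] unfolding isCont_def vector_scalar_mult_def
      by (intro tendsto_intros)
    then have "open G"
      unfolding G_def by (intro open_Int open_ball continuous_open_vimage)
    moreover have "q \<in> G"
      using q \<open>b \<noteq> 0\<close> by (simp add: G_def dist_commute)
    then have "?V \<inter> G \<noteq> {}" using q(1) by blast
    moreover have "?V \<inter> G \<subseteq> \<Union>F"
    proof
      fix z assume z: "z \<in> ?V \<inter> G"
      then have "z \<in> N" using \<delta>(2) by (auto simp: G_def O'(2))
      moreover obtain R where "R \<in> \<S>" "z \<in> R" using z part by blast
      ultimately show "z \<in> \<Union>F" by (auto simp: F_def)
    qed
    ultimately obtain R G' x where R: "R \<in> F" "open G'" "G' \<subseteq> G" "x \<in> R \<inter> G'" "?V \<inter> G' \<subseteq> R"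
      by (rule finite_smooth_cover_interior[OF \<open>finite F\<close> smooth_F])
    have "x \<in> G" using R by blast
    then have "g x \<noteq> 0"
      by (auto simp: G_def)
    moreover have "R \<subseteq> ?V" using part R(1) by (auto simp: F_def)
    ultimately have "tangent_space R x = cplx_hyperplane (g x)"
      using R by (intro tangent_space_eq_cplx_hyperplane[OF fg R(2)]) auto
    then have "P n R"
      unfolding P_def using \<open>x \<in> G\<close> \<open>g x \<noteq> 0\<close> R(4) q(3)
      by (intro bexI[of _ x]) (auto simp: G_def dist_commute intro!: exI[of _ "1/c"])
    then show ?thesis using R(1) by blast
  qed
  moreover have "P m R" if "m \<le> n" "P n R" for m n R
  proof -
    have "1 / Suc n \<le> 1 / Suc m" using that(1) by (simp add: divide_simps)
    then show ?thesis using that(2) unfolding P_def by (meson less_le_trans)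
  qed
  \<comment> \<open>One stratum serves all \<open>n\<close>, so its points form a single sequence
    tending to \<open>p\<close>.\<close>
  ultimately obtain R where R: "R \<in> F" "\<And>n. P n R"
    using finite_antimono_pigeonhole[OF \<open>finite F\<close>, of P] by blast
  then obtain x c where x: "\<And>n. x n \<in> R" "\<And>n. dist (x n) p < 1 / Suc n" "\<And>n. c n \<noteq> 0"
      "\<And>n. dist (c n *s g (x n)) b < 1 / Suc n" "\<And>n. g (x n) \<noteq> 0"
      "\<And>n. tangent_space R (x n) = cplx_hyperplane (g (x n))"
    unfolding P_def by metis
  have lim: "y \<longlonglongrightarrow> l" if lt: "\<And>n. dist (y n) l < 1 / Suc n" for y :: "nat \<Rightarrow> complex ^ 'n" and l
  proof (rule metric_LIMSEQ_I)
    fix e :: real assume "e > 0"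
    then obtain N where N: "1 / real (Suc N) < e" by (rule nat_approx_posE)
    have "dist (y n) l < e" if "N \<le> n" for n
    proof -
      have "1 / real (Suc n) \<le> 1 / real (Suc N)" using that by (simp add: divide_simps)
      then show ?thesis using N lt[of n] by linarith
    qed
    then show "\<exists>N. \<forall>n\<ge>N. dist (y n) l < e" by blast
  qed
  have x_lim: "x \<longlonglongrightarrow> p" and c_lim: "(\<lambda>n. c n *s g (x n)) \<longlonglongrightarrow> b"
    by (rule lim[OF x(2)], rule lim[OF x(4)])
  have tangent: "tangent_space R (x n) = cplx_hyperplane (c n *s g (x n))" for n
    using x(3,6) by (simp add: cplx_hyperplane_scale)
  show ?thesis
  proof (cases "R = S")
    \<comment> \<open>Condition (a) compares two different strata. Here the points
      \<open>x n\<close> lie in the stratum of \<open>p\<close> itself, so \<open>v\<close> is moved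
      to them as a velocity and the limit is taken.\<close>
    case True
    show ?thesis
    proof
      fix v assume v: "v \<in> tangent_space S p"
      obtain k where "smooth_submanifold k S" using smooth S by blast
      then obtain w where w: "w \<longlonglongrightarrow> v"
          "\<forall>\<^sub>F n in sequentially. \<exists>\<gamma> \<epsilon>. \<epsilon> > 0 \<and> (\<forall>t. \<bar>t\<bar> < \<epsilon> \<longrightarrow> \<gamma> t \<in> S) \<and> \<gamma> 0 = x n \<and>
            (\<gamma> has_vector_derivative w n) (at (0::real))"
        using smooth_submanifold_tangent_extension[OF _ S(2) v x_lim] x(1) True by blast
      have "\<forall>\<^sub>F n in sequentially. w n \<in> cplx_hyperplane (c n *s g (x n))"
        using w(2)
      proof eventually_elim
        case (elim n)
        then obtain \<gamma> \<epsilon> where \<gamma>: "\<epsilon> > 0" "\<And>t. \<bar>t\<bar> < \<epsilon> \<Longrightarrow> \<gamma> t \<in> S" "\<gamma> 0 = x n"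
            "(\<gamma> has_vector_derivative w n) (at (0::real))" by blast
        have "f (\<gamma> t) = 0" if "\<bar>t\<bar> < \<epsilon>" for t
          using \<gamma>(2)[OF that] S(1) part by blast
        then have "w n \<in> cplx_hyperplane (g (\<gamma> 0))"
          using velocity_in_cplx_hyperplane[OF fg \<gamma>(1) _ \<gamma>(4)] by blast
        then show ?case using \<gamma>(3) x(3) by (simp add: cplx_hyperplane_scale)
      qed
      then show "v \<in> cplx_hyperplane b"
        by (rule cplx_hyperplane_tendsto_mem[OF c_lim w(1)])
    qed
  next
    case False
    have "R \<in> \<S>" using R(1) by (simp add: F_def)
    \<comment> \<open>Now \<open>S\<close> meets the closure of \<open>R\<close>, so the frontier
      condition puts all of \<open>S\<close> into it and condition (a) becomes available.\<close>
    have "p \<in> closure R" using x(1) x_lim closure_sequential by blast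
    then have "S \<subseteq> closure R"
      by (intro frontier \<open>R \<in> \<S>\<close> S(1)) (use S(2) in blast)
    then have "whitney_condition_a R S"
      by (intro cond_a \<open>R \<in> \<S>\<close> S(1) conjI False)
    moreover have "subspaces_tendsto (\<lambda>n. tangent_space R (x n)) (cplx_hyperplane b)"
      unfolding tangent using x(3,5) \<open>b \<noteq> 0\<close>
      by (intro subspaces_tendsto_cplx_hyperplane c_lim) auto
    ultimately show ?thesis
      using x(1) x_lim S(2) unfolding whitney_condition_a_def by blast
  qed
qed

section \<open>Criticality of the diagonal point\<close>

lemma tangent_space_sum_eq_0:
  fixes f :: "complex ^ 'n::finite \<Rightarrow> complex" and p v :: "complex ^ 'n"
  assumes Q: "\<And>z. f z = symform c UNIV (\<lambda>j. (z - p) $ j)" and "f z0 \<noteq> 0" "f p = 0"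
    and whitney: "whitney_stratification {z. f z = 0} \<S>" and S: "S \<in> \<S>" "p \<in> S"
    and v: "v \<in> tangent_space S p"
  shows "(\<Sum>j\<in>UNIV. v $ j) = 0"
proof -
  \<comment> \<open>\<open>f\<close> is not identically zero, so some coefficient of degree at most
    the number of variables is nonzero.\<close>
  have "\<exists>k\<le>CARD('n). c k \<noteq> 0"
  proof (rule ccontr)
    assume "\<not> ?thesis"
    moreover have "card A \<le> CARD('n)" for A :: "'n set"
      by (rule card_mono) auto
    ultimately have "c (card A) = 0" for A :: "'n set" by blast
    then show False using assms(2) by (simp add: Q symform_def)
  qed
  then obtain k0 where k0: "k0 \<le> CARD('n)" "c k0 \<noteq> 0" by blast
  define m where "m = (LEAST k. c k \<noteq> 0)"
  have "c m \<noteq> 0" "m \<le> CARD('n)"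
    using LeastI[of "\<lambda>k. c k \<noteq> 0" k0] Least_le[of "\<lambda>k. c k \<noteq> 0" k0] k0 by (auto simp: m_def)
  have below: "c k = 0" if "k < m" for k
    using not_less_Least[of k "\<lambda>k. c k \<noteq> 0"] that by (auto simp: m_def)
  \<comment> \<open>The constant term vanishes, so \<open>m\<close> is positive and the sets
    \<open>Y\<close> can have size \<open>m - 1\<close>.\<close>
  have "f p = c 0"
    by (simp add: Q symform_diagonal poly_0_coeff_0 coeff_binomial_poly)
  then have "m \<noteq> 0" using \<open>c m \<noteq> 0\<close> assms(3) by metis
  then obtain k where k: "m = Suc k" using not0_implies_Suc by blast
  have fg: "multiaffine f (\<lambda>z. symform_grad c (z - p))"
    unfolding ext[of f, OF Q] by (rule multiaffine_symform)
  have "(\<Sum>j\<in>- Y. v $ j) = 0" if Y: "card Y = k" for Y :: "'n set"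
  proof -
    define b :: "complex ^ 'n" where "b = (\<chi> j. if j \<in> Y then 0 else 1)"
    have "Y \<noteq> UNIV" using Y k \<open>m \<le> CARD('n)\<close> by auto
    then have "b \<noteq> 0" by (auto simp: b_def vec_eq_iff)
    \<comment> \<open>The existential rebinds \<open>c\<close> as a scalar; \<open>c'\<close> stands
      for the coefficient sequence.\<close>
    have "\<exists>q c. f q = 0 \<and> dist q p < e \<and> c \<noteq> 0 \<and> symform_grad c' (q - p) = c *s b"
      if "e > 0" "c' = c" for e c'
    proof -
      define w where "w = (\<lambda>t. \<chi> j. if j \<in> Y then complex_of_real t else 0)"
      have "(w \<longlongrightarrow> w 0) (at 0)"
        unfolding w_def by (auto intro!: tendsto_eq_intros)
      then have "\<forall>\<^sub>F t in at 0. dist (w t) 0 < e"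
        using \<open>e > 0\<close> by (simp add: w_def tendsto_iff zero_vec_def cong: if_cong)
      then have "\<forall>\<^sub>F t in at 0. norm (w t) < e \<and> t \<noteq> 0"
        by (simp add: eventually_conj_iff eventually_neq_at_within)
      then obtain t where t: "norm (w t) < e" "t \<noteq> 0"
        using eventually_happens[of _ "at (0::real)"] by auto
      \<comment> \<open>The scalar is nonzero because \<open>t\<close> is, so the gradient has the
        direction of \<open>b\<close> however small \<open>t\<close> gets.\<close>
      have "f (p + w t) = 0" "symform_grad c (w t) = (c m * of_real t ^ k) *s b"
        using symform_indicator[of m c Y "of_real t"] below k Y
        by (auto simp: Q w_def b_def vec_eq_iff)
      then show ?thesis
        using t \<open>c m \<noteq> 0\<close> \<open>c' = c\<close>
        by (intro exI[of _ "p + w t"] exI[of _ "c m * of_real t ^ k"]) (simp add: dist_norm)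
    qed
    then have "v \<in> cplx_hyperplane b"
      using whitney_tangent_space_subset[OF whitney fg S \<open>b \<noteq> 0\<close>] v by blast
    then have "(\<Sum>j\<in>UNIV. if j \<in> Y then 0 else v $ j) = 0"
      by (simp add: cplx_hyperplane_def b_def if_distrib[of "\<lambda>a. a * _"] if_distribR cong: if_cong)
    then show ?thesis by (simp add: sum.If_cases)
  qed
  then show ?thesis
    using \<open>m \<le> CARD('n)\<close> k by (intro sum_eq_0_if_subset_sums_eq_0[of k]) auto
qed

section \<open>Criticality and the zero-free polydisk together\<close>

theorem lemma15:
  fixes Q :: "('n::finite, complex) mpolynomial"
    and x :: complex
    and \<S> :: "(complex ^ 'n) set set"
  assumes "symmetric_mpoly Q"
    and "multilinear_mpoly Q"
    and "mpoly_eval Q 0 \<noteq> 0"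
    and "whitney_stratification (zero_locus Q) \<S>"
    and "diagonal Q x = 0"
    and "\<And>y. diagonal Q y = 0 \<Longrightarrow> cmod x \<le> cmod y"
  shows "minimal_point_in_crit Q \<S> (\<chi> j. 1) (\<chi> j. x)"
proof -
  let ?p = "\<chi> j. x :: complex ^ 'n"
  obtain a where a: "\<And>z. mpoly_eval Q z = symform a UNIV (\<lambda>j. z $ j)"
    using mpoly_eval_eq_symform[OF assms(1,2)] by blast
  have "diagonal Q 0 = mpoly_eval Q 0"
    by (simp add: diagonal_def zero_vec_def)
  \<comment> \<open>Logarithmic coordinates need this, and so does the positive radius in the
    Grace-Walsh-Szego theorem.\<close>
  then have "x \<noteq> 0" using assms(3,5) by auto
  obtain c where c: "\<And>w. symform a UNIV (\<lambda>j::'n. x + w j) = symform c UNIV w"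
    by (rule symform_shift[of "UNIV :: 'n set" a x]) auto
  have shift: "mpoly_eval Q z = symform c UNIV (\<lambda>j. (z - ?p) $ j)" for z
    unfolding a c[symmetric] by simp
  have "(\<Sum>j\<in>UNIV. v $ j) = 0" if "S \<in> \<S>" "?p \<in> S" "v \<in> tangent_space S ?p"
    for S and v :: "complex ^ 'n"
    using tangent_space_sum_eq_0[OF shift assms(3) _ assms(4)[unfolded zero_locus_def] that] assms(5)
    by (simp add: diagonal_def)
  \<comment> \<open>For the all-ones direction the logarithmic differential at \<open>?p\<close> is
    the sum of the \<open>v $ j\<close> divided by \<open>x\<close>.\<close>
  then have "?p \<in> crit Q \<S> (\<chi> j. 1)"
    using assms(5) \<open>x \<noteq> 0\<close>
    by (auto simp: crit_def zero_locus_def diagonal_def log_differential_def simp flip: sum_divide_distrib)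
  \<comment> \<open>All radii of the polydisk equal |x|, and minimality of |x| makes the diagonal
    zero-free in the disk of that radius.\<close>
  moreover have "mpoly_eval Q w \<noteq> 0" if "w \<in> open_polydisk ?p" for w
  proof -
    have "symform a UNIV (\<lambda>_::'n. y) \<noteq> 0" if "cmod y < cmod x" for y
    proof -
      have "diagonal Q y \<noteq> 0" using assms(6)[of y] that by linarith
      then show ?thesis by (simp add: diagonal_def a)
    qed
    moreover have "cmod (w $ j) < cmod x" for j
      using that by (simp add: open_polydisk_def)
    ultimately show ?thesis
      unfolding a using \<open>x \<noteq> 0\<close> by - (rule grace_walsh_szego_disk[of UNIV "cmod x"], simp_all)
  qed
  ultimately show ?thesis
    by (auto simp: minimal_point_in_crit_def zero_locus_def)
qed

end
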